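(* In the setting described in the context, let $u_h\in V_h$ and $\hat u_h\in M_h$ be (the velocity components of) the solution $(L_h,u_h,p_h,J_h,b_h,r_h,\hat u_h,\hat p_h,\hat b_h,\hat r_h)\in G_h\times V_h\times Q_h\times H_h\times C_h\times S_h\times M_h\times P_h\times\Lambda_h\times\Gamma_h$ to the E-HDG discretization consisting of (L1)-(L6), (C1)-(C4), (B1)-(B2), (D1)-(D3) and (Z). Then (i) $\nabla\cdot(u_h|_K)=0$ for all $K\in\Omega_h$; (ii) $[\![u_h\cdot n]\!]|_e=0$ for all $e\in\mathcal{E}_h^o$; (iii) $u_h\cdot n=\hat u_h\cdot n$ on $e$, for all $e\in\mathcal{E}_h^\partial$.
   Context: **Domain and mesh.** $\Omega\subset\mathbb{R}^d$, $d\in\{2,3\}$, is a bounded, simply connected domain whose boundary is a Lipschitz manifold with only one component, with a shape-regular triangulation $\Omega_h$ into finitely many nonoverlapping $d$-simplices $K$. $\mathcal{E}_h$ is the set of all facets ($(d-1)$-simplices) of the triangulation, $\mathcal{E}_h^\partial$ the facets contained in $\partial\Omega$, $\mathcal{E}_h^o=\mathcal{E}_h\setminus\mathcal{E}_h^\partial$. $(\cdot,\cdot)_D$ and $\langle\cdot,\cdot\rangle_{D}$ are the $L^2$ inner products on $d$-dimensional, respectively $(d-1)$-dimensional, sets $D$ (componentwise for vectors and matrices). $n$ is the outward unit normal, $N=n\otimes n$, $T=I-N$. On an interior facet $e=\partial K^+\cap\partial K^-$, for a quantity $F$ depending on the element and its normal, $[\![F]\!]=F|_{K^+}+F|_{K^-}$,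 each evaluated with its own outward normal; e.g. $[\![u\cdot n]\!]=u^+\cdot n^++u^-\cdot n^-$. **Conventions.** $(\nabla u)_{ij}=\partial u_i/\partial x_j$, $(\nabla\cdot L)_i=\sum_j\partial L_{ij}/\partial x_j$, $(a\otimes b)_{ij}=a_ib_j$. For $d=3$, curl and cross product are the usual ones. For $d=2$: $\nabla\times b=\partial_1b_2-\partial_2b_1$ for vectors, $\nabla\times a=(\partial_2a,-\partial_1a)$ for scalars, and correspondingly $a\times b=a_1b_2-a_2b_1$ for two vectors, $a\times s=(a_2s,-a_1s)$ for a vector $a$ and a scalar $s$. **Data.** $\mathrm{Re},\mathrm{Rm},\kappa>0$ and $\alpha_1,\beta_1,\beta_2\in\mathbb R$ are constants; $f,g\in[L^2(\Omega)]^d$; $u_D,b_D$ are Dirichlet data on $\partial\Omega$ for velocity and magnetic field, with $\langle u_D\cdot n,1\rangle_{\partial\Omega}=0$; the prescribed fields are $\boldsymbol d\in[W^{1,\infty}(\Omega)]^d$ (magnetic field) and $w\in H(\mathrm{div},\Omega)$ (velocity) with $w|_K\in[W^{1,\infty}(K)]^d$ for all $K\in\Omega_h$ and $\nabla\cdot w=0$; $m:=w\cdot n$. **Spaces.** Fix an integer $k\ge1$; $\tilde d=3$ if $d=3$, $\tilde d=1$ if $d=2$. $\mathcal P_j(\Omega_h)$ (resp. $\mathcal P_j(\mathcal E_h)$) denotes functions that are polynomials of degree at most $j$ on each element (resp. facet), with no continuity imposed; $\mathcal C(\mathcal E_h)$ denotes the continuous functions on the mesh skeleton. Set $G_h=[\mathcal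 P_k(\Omega_h)]^{d\times d}$, $V_h=C_h=[\mathcal P_k(\Omega_h)]^d$, $H_h=[\mathcal P_k(\Omega_h)]^{\tilde d}$, $Q_h=S_h=\mathcal P_{k-1}(\Omega_h)$, $M_h=\Lambda_h=[\mathcal P_k(\mathcal E_h)\cap\mathcal C(\mathcal E_h)]^d$, $P_h=\Gamma_h=\mathcal P_k(\mathcal E_h)$. $V_h(K)$, $M_h(e)$, etc. denote the corresponding spaces on a single element $K$ or a single facet $e$ (restrictions). **Numerical fluxes** on $\partial K$ (normal components): $\hat F^1=-\hat u_h\otimes n$; $\hat F^2=-L_hn+m\,u_h+\hat p_h n+\tfrac12\kappa\,\boldsymbol d\times(n\times(b_h+\hat b_h))+\alpha_1(u_h-\hat u_h)$; $\hat F^3=u_h\cdot n$; $\hat F^4=-n\times\hat b_h$; $\hat F^5=n\times J_h+\hat r_hn-\tfrac12\kappa\,n\times((u_h+\hat u_h)\times\boldsymbol d)+(\beta_1T+\beta_2N)(b_h-\hat b_h)$; $\hat F^6=b_h\cdot n$. **Local equations**, for every $K\in\Omega_h$ and all $(G,v,q,H,c,s)\in G_h(K)\times V_h(K)\times Q_h(K)\times H_h(K)\times C_h(K)\times S_h(K)$: (L1) $\mathrm{Re}(L_h,G)_K+(u_h,\nabla\cdot G)_K+\langle\hat F^1,G\rangle_{\partial K}=0$; (L2) $(L_h,\nabla v)_K-(p_h,\nabla\cdot v)_K-(u_h\otimes w,\nabla v)_K+\kappa(b_h,\nabla\times(v\times\boldsymbol d))_K+\langle\hat F^2,v\rangle_{\partial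 K}=(g,v)_K$; (L3) $-(u_h,\nabla q)_K+\langle\hat F^3,q\rangle_{\partial K}=0$; (L4) $\frac{\mathrm{Rm}}{\kappa}(J_h,H)_K-(b_h,\nabla\times H)_K+\langle\hat F^4,H\rangle_{\partial K}=0$; (L5) $(J_h,\nabla\times c)_K-(r_h,\nabla\cdot c)_K-\kappa(u_h,\boldsymbol d\times(\nabla\times c))_K+\langle\hat F^5,c\rangle_{\partial K}=(f,c)_K$; (L6) $-(b_h,\nabla s)_K+\langle\hat F^6,s\rangle_{\partial K}=0$. **Conservation conditions**, for all $e\in\mathcal E_h^o$ and all $(\mu,\rho,\lambda,\gamma)\in M_h(e)\times P_h(e)\times\Lambda_h(e)\times\Gamma_h(e)$: (C1) $\langle[\![\hat F^2]\!],\mu\rangle_e=0$; (C2) $\langle[\![\hat F^3]\!],\rho\rangle_e=0$; (C3) $\langle[\![\hat F^5]\!],\lambda\rangle_e=0$; (C4) $\langle[\![\hat F^6]\!],\gamma\rangle_e=0$. **Boundary constraints**, for all $e\in\mathcal E_h^\partial$: (B1) $\langle\hat u_h\cdot n,\rho\rangle_e=\langle u_h\cdot n,\rho\rangle_e$ for all $\rho\in P_h(e)$; (B2) $\langle\hat b_h\cdot n,\gamma\rangle_e=\langle b_h\cdot n,\gamma\rangle_e$ for all $\gamma\in\Gamma_h(e)$. **Boundary conditions**, for all $e\in\mathcal E_h^\partial$ and all $(\mu,\lambda,\gamma)\in M_h(e)\times\Lambda_h(e)\times\Gamma_h(e)$: (D1) $\langle\hat u_h,\mu\rangle_e=\langle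 u_D,\mu\rangle_e$; (D2) $\langle\hat b_h,\lambda\rangle_e=\langle b_D,\lambda\rangle_e$; (D3) $\langle\hat r_h,\gamma\rangle_e=0$. **Mean value condition:** (Z) $(p_h,1)_\Omega=0$. *)

theory Defs
  imports "HOL-Analysis.Analysis"
begin

unbundle no cross3_syntax

section \<open>Differential operators\<close>

text \<open>
  Derivatives are taken within the set on which a function lives, so that only its values on
  that set matter.  On a nondegenerate simplex the derivative within the simplex is unique,
  also at boundary points.
\<close>

definition partial_on :: "(real^'d) set \<Rightarrow> 'd \<Rightarrow> (real^'d \<Rightarrow> real) \<Rightarrow> real^'d \<Rightarrow> real" where
  "partial_on S j f x = frechet_derivative f (at x within S) (axis j 1)"

definition grad_on :: "(real^'d) set \<Rightarrow> (real^'d \<Rightarrow> real) \<Rightarrow> real^'d \<Rightarrow> real^'d" where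
  "grad_on S f x = (\<chi> j. partial_on S j f x)"

definition jac_on :: "(real^'d) set \<Rightarrow> (real^'d \<Rightarrow> real^'m) \<Rightarrow> real^'d \<Rightarrow> real^'d^'m" where
  "jac_on S v x = (\<chi> i j. partial_on S j (\<lambda>y. v y $ i) x)"

definition div_on :: "(real^'d) set \<Rightarrow> (real^'d \<Rightarrow> real^'d) \<Rightarrow> real^'d \<Rightarrow> real" where
  "div_on S v x = (\<Sum>j\<in>UNIV. partial_on S j (\<lambda>y. v y $ j) x)"

definition mdiv_on :: "(real^'d) set \<Rightarrow> (real^'d \<Rightarrow> real^'d^'d) \<Rightarrow> real^'d \<Rightarrow> real^'d" where
  "mdiv_on S G x = (\<chi> i. \<Sum>j\<in>UNIV. partial_on S j (\<lambda>y. G y $ i $ j) x)"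

definition outer :: "real^'d \<Rightarrow> real^'d \<Rightarrow> real^'d^'d" where
  "outer a b = (\<chi> i j. a $ i * b $ j)"


subsection \<open>Cross products and curls in dimensions two and three\<close>

text \<open>
  \<^typ>\<open>'h\<close> indexes the components of the current: type 1 for \<open>d = 2\<close>, so that scalars are
  elements of \<^typ>\<open>real^1\<close>, and type 3 for \<open>d = 3\<close>.  The two curls are functions of a
  Jacobian matrix (rows: components, columns: derivatives), which allows them to be applied to
  classical and to weak derivatives.
\<close>

record ('d, 'h) cross_calculus =
  cross_vv :: "real^'d \<Rightarrow> real^'d \<Rightarrow> real^'h"
  cross_vh :: "real^'d \<Rightarrow> real^'h \<Rightarrow> real^'d"
  curl_v :: "real^'d^'d \<Rightarrow> real^'h"
  curl_h :: "real^'d^'h \<Rightarrow> real^'d"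

definition calculus_2d :: "(2, 1) cross_calculus" where
  "calculus_2d = \<lparr>
     cross_vv = (\<lambda>a b. vector [a$1 * b$2 - a$2 * b$1]),
     cross_vh = (\<lambda>a s. vector [a$2 * s$1, - (a$1 * s$1)]),
     curl_v = (\<lambda>A. vector [A$2$1 - A$1$2]),
     curl_h = (\<lambda>A. vector [A$1$2, - (A$1$1)]) \<rparr>"

definition curl_of_jac :: "real^3^3 \<Rightarrow> real^3" where
  "curl_of_jac A = vector [A$3$2 - A$2$3, A$1$3 - A$3$1, A$2$1 - A$1$2]"

definition calculus_3d :: "(3, 3) cross_calculus" where
  "calculus_3d = \<lparr>
     cross_vv = cross3,
     cross_vh = cross3,
     curl_v = curl_of_jac,
     curl_h = curl_of_jac \<rparr>"


section \<open>Function spaces on open sets\<close>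

definition L2_on :: "'a::euclidean_space set \<Rightarrow> ('a \<Rightarrow> 'b::euclidean_space) \<Rightarrow> bool" where
  "L2_on U f \<longleftrightarrow> f \<in> borel_measurable (lebesgue_on U) \<and>
     integrable (lebesgue_on U) (\<lambda>x. (norm (f x))\<^sup>2)"

definition Linf_on :: "'a::euclidean_space set \<Rightarrow> ('a \<Rightarrow> real) \<Rightarrow> bool" where
  "Linf_on U f \<longleftrightarrow> f \<in> borel_measurable (lebesgue_on U) \<and>
     (\<exists>B. AE x in lebesgue_on U. \<bar>f x\<bar> \<le> B)"

definition L1_loc_on :: "'a::euclidean_space set \<Rightarrow> ('a \<Rightarrow> real) \<Rightarrow> bool" where
  "L1_loc_on U f \<longleftrightarrow> (\<forall>C. compact C \<and> C \<subseteq> U \<longrightarrow> set_integrable lebesgue C f)"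

primrec C_diff :: "nat \<Rightarrow> (real^'d \<Rightarrow> real) \<Rightarrow> bool" where
  "C_diff 0 f \<longleftrightarrow> continuous_on UNIV f"
| "C_diff (Suc m) f \<longleftrightarrow> (\<forall>x. f differentiable (at x)) \<and> (\<forall>j. C_diff m (partial_on UNIV j f))"

definition test_function :: "(real^'d) set \<Rightarrow> (real^'d \<Rightarrow> real) \<Rightarrow> bool" where
  "test_function U \<phi> \<longleftrightarrow> (\<forall>m. C_diff m \<phi>) \<and>
     compact (closure {x. \<phi> x \<noteq> 0}) \<and> closure {x. \<phi> x \<noteq> 0} \<subseteq> U"

definition is_weak_partial ::
    "(real^'d) set \<Rightarrow> 'd \<Rightarrow> (real^'d \<Rightarrow> real) \<Rightarrow> (real^'d \<Rightarrow> real) \<Rightarrow> bool" where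
  "is_weak_partial U j f g \<longleftrightarrow> L1_loc_on U f \<and> L1_loc_on U g \<and>
     (\<forall>\<phi>. test_function U \<phi> \<longrightarrow>
        (LINT x:U|lebesgue. f x * partial_on UNIV j \<phi> x) = - (LINT x:U|lebesgue. g x * \<phi> x))"

text \<open>Weak derivatives are determined only up to null sets; some representative is chosen.\<close>

definition weak_partial :: "(real^'d) set \<Rightarrow> 'd \<Rightarrow> (real^'d \<Rightarrow> real) \<Rightarrow> real^'d \<Rightarrow> real" where
  "weak_partial U j f = (SOME g. is_weak_partial U j f g)"

definition weak_jac :: "(real^'d) set \<Rightarrow> (real^'d \<Rightarrow> real^'m) \<Rightarrow> real^'d \<Rightarrow> real^'d^'m" where
  "weak_jac U v x = (\<chi> i j. weak_partial U j (\<lambda>y. v y $ i) x)"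

definition is_weak_div :: "(real^'d) set \<Rightarrow> (real^'d \<Rightarrow> real^'d) \<Rightarrow> (real^'d \<Rightarrow> real) \<Rightarrow> bool" where
  "is_weak_div U v h \<longleftrightarrow> (\<forall>i. L1_loc_on U (\<lambda>x. v x $ i)) \<and> L1_loc_on U h \<and>
     (\<forall>\<phi>. test_function U \<phi> \<longrightarrow>
        (LINT x:U|lebesgue. v x \<bullet> grad_on UNIV \<phi> x) = - (LINT x:U|lebesgue. h x * \<phi> x))"

definition H_div :: "(real^'d) set \<Rightarrow> (real^'d \<Rightarrow> real^'d) \<Rightarrow> bool" where
  "H_div U v \<longleftrightarrow> L2_on U v \<and> (\<exists>h. L2_on U h \<and> is_weak_div U v h)"

definition W1_inf :: "(real^'d) set \<Rightarrow> (real^'d \<Rightarrow> real^'m) \<Rightarrow> bool" where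
  "W1_inf U v \<longleftrightarrow> (\<forall>i. Linf_on U (\<lambda>x. v x $ i) \<and>
     (\<forall>j. \<exists>g. Linf_on U g \<and> is_weak_partial U j (\<lambda>x. v x $ i) g))"

text \<open>
  A \<open>W\<^sup>1\<^sup>,\<^sup>\<infinity>\<close> function on the interior of a simplex \<open>K\<close> has a unique representative that is
  continuous on \<open>K\<close>; the trace on the boundary of \<open>K\<close> is given by its values there.
\<close>

definition trace_on :: "(real^'d) set \<Rightarrow> (real^'d \<Rightarrow> real^'m) \<Rightarrow> real^'d \<Rightarrow> real^'m" where
  "trace_on K v = (SOME g. continuous_on K g \<and> (AE x in lebesgue_on K. g x = v x))"


section \<open>Domain and mesh\<close>

text \<open>
  A topological hypersurface with bi-Lipschitz charts; the chart domains are open subsets of a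
  linear hyperplane, in place of \<open>\<real>\<^sup>d\<^sup>-\<^sup>1\<close>.
\<close>

definition lipschitz_hypersurface :: "'a::euclidean_space set \<Rightarrow> bool" where
  "lipschitz_hypersurface M \<longleftrightarrow>
     (\<forall>x\<in>M. \<exists>(U :: 'a set) (V :: 'a set) (a :: 'a) \<phi> \<psi> C.
        open U \<and> x \<in> U \<and> a \<noteq> 0 \<and> openin (top_of_set {y. a \<bullet> y = 0}) V \<and>
        homeomorphism (M \<inter> U) V \<phi> \<psi> \<and> C-lipschitz_on (M \<inter> U) \<phi> \<and> C-lipschitz_on V \<psi>)"

definition admissible_domain :: "'a::euclidean_space set \<Rightarrow> bool" where
  "admissible_domain \<Omega> \<longleftrightarrow> open \<Omega> \<and> connected \<Omega> \<and> \<Omega> \<noteq> {} \<and> bounded \<Omega> \<and> simply_connected \<Omega> \<and>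
     lipschitz_hypersurface (frontier \<Omega>) \<and> connected (frontier \<Omega>)"

text \<open>Elements are closed simplices, and \<^const>\<open>triangulation\<close> includes finiteness and conformity.\<close>

definition mesh_of :: "'a::euclidean_space set \<Rightarrow> 'a set set \<Rightarrow> bool" where
  "mesh_of \<Omega> \<T> \<longleftrightarrow> triangulation \<T> \<and> (\<forall>K\<in>\<T>. int DIM('a) simplex K) \<and> \<Union>\<T> = closure \<Omega>"

definition shape_regular :: "real \<Rightarrow> 'a::euclidean_space set set \<Rightarrow> bool" where
  "shape_regular \<sigma> \<T> \<longleftrightarrow> \<sigma> > 0 \<and> (\<forall>K\<in>\<T>. \<exists>x. cball x (diameter K / \<sigma>) \<subseteq> K)"

definition facets :: "'a::euclidean_space set set \<Rightarrow> 'a set set" where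
  "facets \<T> = {e. \<exists>K\<in>\<T>. e facet_of K}"

definition boundary_facets :: "'a::euclidean_space set \<Rightarrow> 'a set set \<Rightarrow> 'a set set" where
  "boundary_facets \<Omega> \<T> = {e \<in> facets \<T>. e \<subseteq> frontier \<Omega>}"

definition interior_facets :: "'a::euclidean_space set \<Rightarrow> 'a set set \<Rightarrow> 'a set set" where
  "interior_facets \<Omega> \<T> = facets \<T> - boundary_facets \<Omega> \<T>"

definition facet_between :: "'a::euclidean_space set set \<Rightarrow> 'a set \<Rightarrow> 'a set \<Rightarrow> 'a set \<Rightarrow> bool" where
  "facet_between \<T> e K\<^sub>1 K\<^sub>2 \<longleftrightarrow> K\<^sub>1 \<in> \<T> \<and> K\<^sub>2 \<in> \<T> \<and> K\<^sub>1 \<noteq> K\<^sub>2 \<and> e = frontier K\<^sub>1 \<inter> frontier K\<^sub>2"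

definition outward_normal :: "'a::euclidean_space set \<Rightarrow> 'a set \<Rightarrow> 'a" where
  "outward_normal K e = (THE n. norm n = 1 \<and> (\<forall>x\<in>e. \<forall>y\<in>K. n \<bullet> (y - x) \<le> 0))"


section \<open>Inner products\<close>

text \<open>
  The \<open>(d-1)\<close>-dimensional measure of a subset \<open>A\<close> of a facet \<open>e\<close> with unit normal \<open>n\<close> is the
  \<open>d\<close>-dimensional Lebesgue measure of the right prism \<open>{x + t n | x \<in> A, 0 \<le> t \<le> 1}\<close> of height
  one over it (by Fubini this is Lebesgue measure on the hyperplane of \<open>e\<close>).  Accordingly a function on \<open>e\<close> is integrated by extending it to the prism over
  \<open>e\<close> constantly along \<open>n\<close>.  The choice of the sign of \<open>n\<close> is immaterial.
\<close>

definition facet_normal :: "'a::euclidean_space set \<Rightarrow> 'a" where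
  "facet_normal e = (SOME n. norm n = 1 \<and> (\<forall>x\<in>e. \<forall>y\<in>e. n \<bullet> (y - x) = 0))"

definition facet_prism :: "'a::euclidean_space set \<Rightarrow> 'a set" where
  "facet_prism e = {x + t *\<^sub>R facet_normal e | x t. x \<in> e \<and> 0 \<le> t \<and> t \<le> 1}"

definition facet_proj :: "'a::euclidean_space set \<Rightarrow> 'a \<Rightarrow> 'a" where
  "facet_proj e z = z - (facet_normal e \<bullet> (z - (SOME a. a \<in> e))) *\<^sub>R facet_normal e"

definition facet_integral :: "'a::euclidean_space set \<Rightarrow> ('a \<Rightarrow> real) \<Rightarrow> real" where
  "facet_integral e f = (LINT z:facet_prism e|lebesgue. f (facet_proj e z))"

definition facet_L2 :: "'a::euclidean_space set \<Rightarrow> ('a \<Rightarrow> 'b::euclidean_space) \<Rightarrow> bool" where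
  "facet_L2 e f \<longleftrightarrow> L2_on (facet_prism e) (\<lambda>z. f (facet_proj e z))"

definition vol_ip :: "'a::euclidean_space set \<Rightarrow> ('a \<Rightarrow> 'b::real_inner) \<Rightarrow> ('a \<Rightarrow> 'b) \<Rightarrow> real" where
  "vol_ip D f g = (LINT x:D|lebesgue. f x \<bullet> g x)"

definition facet_ip :: "'a::euclidean_space set \<Rightarrow> ('a \<Rightarrow> 'b::real_inner) \<Rightarrow> ('a \<Rightarrow> 'b) \<Rightarrow> real" where
  "facet_ip e f g = facet_integral e (\<lambda>x. f x \<bullet> g x)"

definition bdry_ip ::
    "'a::euclidean_space set \<Rightarrow> ('a set \<Rightarrow> 'a \<Rightarrow> 'b::real_inner) \<Rightarrow> ('a \<Rightarrow> 'b) \<Rightarrow> real" where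
  "bdry_ip K F g = (\<Sum>e | e facet_of K. facet_ip e (F e) g)"


section \<open>Polynomial spaces\<close>

definition polys :: "nat \<Rightarrow> (real^'d \<Rightarrow> real) set" where
  "polys j = {p. \<exists>c. p = (\<lambda>x. \<Sum>a | sum a UNIV \<le> j. c a * (\<Prod>i\<in>UNIV. x $ i ^ a i))}"

definition poly_on :: "nat \<Rightarrow> (real^'d) set \<Rightarrow> (real^'d \<Rightarrow> real) \<Rightarrow> bool" where
  "poly_on j S f \<longleftrightarrow> (\<exists>p\<in>polys j. \<forall>x\<in>S. f x = p x)"

definition vpoly_on :: "nat \<Rightarrow> (real^'d) set \<Rightarrow> (real^'d \<Rightarrow> real^'m) \<Rightarrow> bool" where
  "vpoly_on j S v \<longleftrightarrow> (\<forall>i. poly_on j S (\<lambda>x. v x $ i))"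

definition mpoly_on :: "nat \<Rightarrow> (real^'d) set \<Rightarrow> (real^'d \<Rightarrow> real^'d^'d) \<Rightarrow> bool" where
  "mpoly_on j S G \<longleftrightarrow> (\<forall>i l. poly_on j S (\<lambda>x. G x $ i $ l))"

definition trace_space :: "nat \<Rightarrow> (real^'d) set set \<Rightarrow> (real^'d \<Rightarrow> real^'d) set" where
  "trace_space k \<T> =
     {\<mu>. continuous_on (\<Union>(facets \<T>)) \<mu> \<and> (\<forall>e\<in>facets \<T>. vpoly_on k e \<mu>)}"


section \<open>The E-HDG discretization\<close>

record 'd mhd_data =
  Re_num :: real
  Rm_num :: real
  kappa :: real
  alpha1 :: real
  beta1 :: real
  beta2 :: real
  f_src :: "real^'d \<Rightarrow> real^'d"
  g_src :: "real^'d \<Rightarrow> real^'d"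
  u_D :: "real^'d \<Rightarrow> real^'d"
  b_D :: "real^'d \<Rightarrow> real^'d"
  d_fld :: "real^'d \<Rightarrow> real^'d"
  w_fld :: "real^'d \<Rightarrow> real^'d"

definition admissible_data :: "(real^'d) set \<Rightarrow> (real^'d) set set \<Rightarrow> 'd mhd_data \<Rightarrow> bool" where
  "admissible_data \<Omega> \<T> D \<longleftrightarrow>
     Re_num D > 0 \<and> Rm_num D > 0 \<and> kappa D > 0 \<and>
     L2_on \<Omega> (f_src D) \<and> L2_on \<Omega> (g_src D) \<and>
     (\<forall>e\<in>boundary_facets \<Omega> \<T>. facet_L2 e (u_D D) \<and> facet_L2 e (b_D D)) \<and>
     (\<Sum>K\<in>\<T>. \<Sum>e | e facet_of K \<and> e \<in> boundary_facets \<Omega> \<T>.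
        facet_ip e (\<lambda>x. u_D D x \<bullet> outward_normal K e) (\<lambda>_. 1)) = 0 \<and>
     W1_inf \<Omega> (d_fld D) \<and>
     H_div \<Omega> (w_fld D) \<and> (\<forall>K\<in>\<T>. W1_inf (interior K) (w_fld D)) \<and>
     is_weak_div \<Omega> (w_fld D) (\<lambda>_. 0)"

text \<open>
  Discontinuous unknowns are families indexed by elements (or facets): \<open>u_h S K\<close> is the
  restriction of \<open>u\<^sub>h\<close> to \<open>K\<close>, and its values on the boundary of \<open>K\<close> are the one-sided traces.
  Only the values of \<open>u_h S K\<close> on \<open>K\<close> are relevant.
\<close>

record ('d, 'h) ehdg_unknowns =
  L_h :: "(real^'d) set \<Rightarrow> real^'d \<Rightarrow> real^'d^'d"
  u_h :: "(real^'d) set \<Rightarrow> real^'d \<Rightarrow> real^'d"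
  p_h :: "(real^'d) set \<Rightarrow> real^'d \<Rightarrow> real"
  J_h :: "(real^'d) set \<Rightarrow> real^'d \<Rightarrow> real^'h"
  b_h :: "(real^'d) set \<Rightarrow> real^'d \<Rightarrow> real^'d"
  r_h :: "(real^'d) set \<Rightarrow> real^'d \<Rightarrow> real"
  u_hat :: "real^'d \<Rightarrow> real^'d"
  p_hat :: "(real^'d) set \<Rightarrow> real^'d \<Rightarrow> real"
  b_hat :: "real^'d \<Rightarrow> real^'d"
  r_hat :: "(real^'d) set \<Rightarrow> real^'d \<Rightarrow> real"

definition ehdg_spaces :: "nat \<Rightarrow> (real^'d) set set \<Rightarrow> ('d, 'h::finite) ehdg_unknowns \<Rightarrow> bool" where
  "ehdg_spaces k \<T> S \<longleftrightarrow>
     (\<forall>K\<in>\<T>. mpoly_on k K (L_h S K) \<and> vpoly_on k K (u_h S K) \<and> poly_on (k - 1) K (p_h S K) \<and>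
            vpoly_on k K (J_h S K) \<and> vpoly_on k K (b_h S K) \<and> poly_on (k - 1) K (r_h S K)) \<and>
     u_hat S \<in> trace_space k \<T> \<and> b_hat S \<in> trace_space k \<T> \<and>
     (\<forall>e\<in>facets \<T>. poly_on k e (p_hat S e) \<and> poly_on k e (r_hat S e))"

subsection \<open>Numerical fluxes\<close>

definition flux1 ::
    "('d, 'h::finite) ehdg_unknowns \<Rightarrow> (real^'d) set \<Rightarrow> (real^'d) set \<Rightarrow> real^'d \<Rightarrow> real^'d^'d" where
  "flux1 S K e x = - outer (u_hat S x) (outward_normal K e)"

definition flux2 ::
    "('d, 'h::finite) cross_calculus \<Rightarrow> 'd mhd_data \<Rightarrow> ('d, 'h::finite) ehdg_unknowns \<Rightarrow>
     (real^'d) set \<Rightarrow> (real^'d) set \<Rightarrow> real^'d \<Rightarrow> real^'d" where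
  "flux2 X D S K e x =
     (let n = outward_normal K e; m = trace_on K (w_fld D) x \<bullet> n in
        - (L_h S K x *v n) + m *\<^sub>R u_h S K x + p_hat S e x *\<^sub>R n
        + (1/2 * kappa D) *\<^sub>R
            cross_vh X (trace_on K (d_fld D) x) (cross_vv X n (b_h S K x + b_hat S x))
        + alpha1 D *\<^sub>R (u_h S K x - u_hat S x))"

definition flux3 ::
    "('d, 'h::finite) ehdg_unknowns \<Rightarrow> (real^'d) set \<Rightarrow> (real^'d) set \<Rightarrow> real^'d \<Rightarrow> real" where
  "flux3 S K e x = u_h S K x \<bullet> outward_normal K e"

definition flux4 ::
    "('d, 'h::finite) cross_calculus \<Rightarrow> ('d, 'h::finite) ehdg_unknowns \<Rightarrow>
     (real^'d) set \<Rightarrow> (real^'d) set \<Rightarrow> real^'d \<Rightarrow> real^'h" where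
  "flux4 X S K e x = - cross_vv X (outward_normal K e) (b_hat S x)"

definition flux5 ::
    "('d, 'h::finite) cross_calculus \<Rightarrow> 'd mhd_data \<Rightarrow> ('d, 'h::finite) ehdg_unknowns \<Rightarrow>
     (real^'d) set \<Rightarrow> (real^'d) set \<Rightarrow> real^'d \<Rightarrow> real^'d" where
  "flux5 X D S K e x =
     (let n = outward_normal K e; N = outer n n; T = mat 1 - N in
        cross_vh X n (J_h S K x) + r_hat S e x *\<^sub>R n
        - (1/2 * kappa D) *\<^sub>R
            cross_vh X n (cross_vv X (u_h S K x + u_hat S x) (trace_on K (d_fld D) x))
        + (beta1 D *\<^sub>R T + beta2 D *\<^sub>R N) *v (b_h S K x - b_hat S x))"

definition flux6 ::
    "('d, 'h::finite) ehdg_unknowns \<Rightarrow> (real^'d) set \<Rightarrow> (real^'d) set \<Rightarrow> real^'d \<Rightarrow> real" where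
  "flux6 S K e x = b_h S K x \<bullet> outward_normal K e"

subsection \<open>Local equations\<close>

definition local_equations ::
    "('d, 'h::finite) cross_calculus \<Rightarrow> nat \<Rightarrow> 'd mhd_data \<Rightarrow> ('d, 'h::finite) ehdg_unknowns \<Rightarrow>
     (real^'d) set \<Rightarrow> bool" where
  "local_equations X k D S K \<longleftrightarrow>
     (\<forall>G. mpoly_on k K G \<longrightarrow>
        Re_num D * vol_ip K (L_h S K) G + vol_ip K (u_h S K) (mdiv_on K G)
        + bdry_ip K (flux1 S K) G = 0) \<and>
     (\<forall>v. vpoly_on k K v \<longrightarrow>
        vol_ip K (L_h S K) (jac_on K v) - vol_ip K (p_h S K) (div_on K v)
        - vol_ip K (\<lambda>x. outer (u_h S K x) (w_fld D x)) (jac_on K v)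
        + kappa D * vol_ip K (b_h S K)
            (\<lambda>x. curl_h X (weak_jac (interior K) (\<lambda>y. cross_vv X (v y) (d_fld D y)) x))
        + bdry_ip K (flux2 X D S K) v
        = vol_ip K (g_src D) v) \<and>
     (\<forall>q. poly_on (k - 1) K q \<longrightarrow>
        - vol_ip K (u_h S K) (grad_on K q) + bdry_ip K (flux3 S K) q = 0) \<and>
     (\<forall>H. vpoly_on k K H \<longrightarrow>
        Rm_num D / kappa D * vol_ip K (J_h S K) H
        - vol_ip K (b_h S K) (\<lambda>x. curl_h X (jac_on K H x))
        + bdry_ip K (flux4 X S K) H = 0) \<and>
     (\<forall>c. vpoly_on k K c \<longrightarrow>
        vol_ip K (J_h S K) (\<lambda>x. curl_v X (jac_on K c x)) - vol_ip K (r_h S K) (div_on K c)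
        - kappa D * vol_ip K (u_h S K) (\<lambda>x. cross_vh X (d_fld D x) (curl_v X (jac_on K c x)))
        + bdry_ip K (flux5 X D S K) c
        = vol_ip K (f_src D) c) \<and>
     (\<forall>s. poly_on (k - 1) K s \<longrightarrow>
        - vol_ip K (b_h S K) (grad_on K s) + bdry_ip K (flux6 S K) s = 0)"

subsection \<open>Conservation, boundary and mean value conditions\<close>

definition jump ::
    "((real^'d) set \<Rightarrow> (real^'d) set \<Rightarrow> real^'d \<Rightarrow> 'b::real_vector) \<Rightarrow>
     (real^'d) set \<Rightarrow> (real^'d) set \<Rightarrow> (real^'d) set \<Rightarrow> real^'d \<Rightarrow> 'b" where
  "jump F K\<^sub>1 K\<^sub>2 e x = F K\<^sub>1 e x + F K\<^sub>2 e x"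

definition conservation_conditions ::
    "('d, 'h::finite) cross_calculus \<Rightarrow> (real^'d) set \<Rightarrow> (real^'d) set set \<Rightarrow> nat \<Rightarrow> 'd mhd_data \<Rightarrow>
     ('d, 'h::finite) ehdg_unknowns \<Rightarrow> bool" where
  "conservation_conditions X \<Omega> \<T> k D S \<longleftrightarrow>
     (\<forall>e\<in>interior_facets \<Omega> \<T>. \<forall>K\<^sub>1 K\<^sub>2. facet_between \<T> e K\<^sub>1 K\<^sub>2 \<longrightarrow>
        (\<forall>\<mu>\<in>trace_space k \<T>. facet_ip e (jump (flux2 X D S) K\<^sub>1 K\<^sub>2 e) \<mu> = 0) \<and>
        (\<forall>\<rho>. poly_on k e \<rho> \<longrightarrow> facet_ip e (jump (flux3 S) K\<^sub>1 K\<^sub>2 e) \<rho> = 0) \<and>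
        (\<forall>l\<in>trace_space k \<T>. facet_ip e (jump (flux5 X D S) K\<^sub>1 K\<^sub>2 e) l = 0) \<and>
        (\<forall>\<gamma>. poly_on k e \<gamma> \<longrightarrow> facet_ip e (jump (flux6 S) K\<^sub>1 K\<^sub>2 e) \<gamma> = 0))"

definition boundary_constraints ::
    "(real^'d) set \<Rightarrow> (real^'d) set set \<Rightarrow> nat \<Rightarrow> ('d, 'h::finite) ehdg_unknowns \<Rightarrow> bool" where
  "boundary_constraints \<Omega> \<T> k S \<longleftrightarrow>
     (\<forall>e\<in>boundary_facets \<Omega> \<T>. \<forall>K\<in>\<T>. e facet_of K \<longrightarrow>
        (let n = outward_normal K e in
          (\<forall>\<rho>. poly_on k e \<rho> \<longrightarrow>
             facet_ip e (\<lambda>x. u_hat S x \<bullet> n) \<rho> = facet_ip e (\<lambda>x. u_h S K x \<bullet> n) \<rho>) \<and>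
          (\<forall>\<gamma>. poly_on k e \<gamma> \<longrightarrow>
             facet_ip e (\<lambda>x. b_hat S x \<bullet> n) \<gamma> = facet_ip e (\<lambda>x. b_h S K x \<bullet> n) \<gamma>)))"

definition boundary_conditions ::
    "(real^'d) set \<Rightarrow> (real^'d) set set \<Rightarrow> nat \<Rightarrow> 'd mhd_data \<Rightarrow> ('d, 'h::finite) ehdg_unknowns \<Rightarrow> bool" where
  "boundary_conditions \<Omega> \<T> k D S \<longleftrightarrow>
     (\<forall>e\<in>boundary_facets \<Omega> \<T>.
        (\<forall>\<mu>\<in>trace_space k \<T>. facet_ip e (u_hat S) \<mu> = facet_ip e (u_D D) \<mu>) \<and>
        (\<forall>l\<in>trace_space k \<T>. facet_ip e (b_hat S) l = facet_ip e (b_D D) l) \<and>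
        (\<forall>\<gamma>. poly_on k e \<gamma> \<longrightarrow> facet_ip e (r_hat S e) \<gamma> = 0))"

definition ehdg_solution ::
    "('d, 'h::finite) cross_calculus \<Rightarrow> (real^'d) set \<Rightarrow> (real^'d) set set \<Rightarrow> nat \<Rightarrow> 'd mhd_data \<Rightarrow>
     ('d, 'h::finite) ehdg_unknowns \<Rightarrow> bool" where
  "ehdg_solution X \<Omega> \<T> k D S \<longleftrightarrow>
     ehdg_spaces k \<T> S \<and>
     (\<forall>K\<in>\<T>. local_equations X k D S K) \<and>
     conservation_conditions X \<Omega> \<T> k D S \<and>
     boundary_constraints \<Omega> \<T> k S \<and>
     boundary_conditions \<Omega> \<T> k D S \<and>
     (\<Sum>K\<in>\<T>. vol_ip K (p_h S K) (\<lambda>_. 1)) = 0"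

end

theory Submission
  imports Defs
begin

text \<open>
  Equation (L3), integrated by parts, says that the divergence of the velocity is orthogonal to
  all polynomials of degree \<open>k - 1\<close> on an element; it is such a polynomial itself, hence zero.
  Likewise the jump of the normal velocity on an interior facet, and the difference of the two
  normal velocities on a boundary facet, are admissible test functions in (C2) and (B1).

  The integration by parts rests on the divergence theorem for a polytope \<open>K\<close>.  Moving \<open>K\<close> by
  \<open>t v\<close> sweeps out \<open>K + [0,t] v\<close>, which is the union of \<open>K\<close> and the prisms \<open>e + [0,t] v\<close> over the
  facets \<open>e\<close> where \<open>v\<close> points outwards, and also the union of \<open>K + t v\<close> and the prisms over the
  facets where \<open>v\<close> points inwards, all overlaps being null sets.  So
  \<open>\<integral>\<^sub>K f(x + t v) - f(x) dx\<close> is a signed sum of integrals over prisms, each of which is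
  \<open>t \<bar>n \<bullet> v\<bar>\<close> times an integral over the facet prism of height one; divide by \<open>t\<close> and let
  \<open>t\<close> tend to 0.
\<close>

subsection \<open>Polynomials and derivatives within convex sets\<close>

text \<open>Needed to compute with the sums in \<open>polys\<close>: over an infinite index set such
  a sum would be 0 by convention.\<close>

lemma finite_exponents: "finite {a :: 'd::finite \<Rightarrow> nat. sum a UNIV \<le> j}"
proof (rule finite_subset)
  show "{a :: 'd \<Rightarrow> nat. sum a UNIV \<le> j} \<subseteq> PiE UNIV (\<lambda>_. {..j})"
  proof
    fix a :: "'d \<Rightarrow> nat" assume "a \<in> {a. sum a UNIV \<le> j}"
    then have "a i \<le> j" for i using member_le_sum[of i UNIV a] by simp
    then show "a \<in> PiE UNIV (\<lambda>_. {..j})" by auto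
  qed
qed (auto intro!: finite_PiE)

lemma polys_monomial:
  fixes a :: "'d::finite \<Rightarrow> nat"
  assumes "sum a UNIV \<le> j"
  shows "(\<lambda>x::real^'d. \<Prod>i\<in>UNIV. x $ i ^ a i) \<in> polys j"
proof -
  have "(\<Sum>b | sum b UNIV \<le> j. (if b = a then 1 else 0) * (\<Prod>i\<in>UNIV. (x::real^'d) $ i ^ b i)) =
    (\<Prod>i\<in>UNIV. x $ i ^ a i)" for x
    using assms finite_exponents[of j, where 'd='d]
    by (simp add: if_distrib[of "\<lambda>t. t * _"] sum.delta cong: if_cong)
  then show ?thesis
    unfolding polys_def by (auto intro!: exI[of _ "\<lambda>b. if b = a then 1 else 0"])
qed

section \<open>Closure of the polynomial spaces under linear operations\<close>

lemma polys_add: "p \<in> polys j \<Longrightarrow> q \<in> polys j \<Longrightarrow> (\<lambda>x. p x + q x) \<in> polys j"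
  unfolding polys_def
proof clarify
  fix c c' :: "('a \<Rightarrow> nat) \<Rightarrow> real"
  show "\<exists>d. (\<lambda>x. (\<Sum>a | sum a UNIV \<le> j. c a * (\<Prod>i\<in>UNIV. x $ i ^ a i)) +
      (\<Sum>a | sum a UNIV \<le> j. c' a * (\<Prod>i\<in>UNIV. x $ i ^ a i))) =
    (\<lambda>x. \<Sum>a | sum a UNIV \<le> j. d a * (\<Prod>i\<in>UNIV. x $ i ^ a i))"
    by (intro exI[of _ "\<lambda>a. c a + c' a"]) (simp add: sum.distrib distrib_right)
qed

lemma polys_cmult: "p \<in> polys j \<Longrightarrow> (\<lambda>x. r * p x) \<in> polys j"
  unfolding polys_def
proof clarify
  fix c :: "('a \<Rightarrow> nat) \<Rightarrow> real"
  show "\<exists>d. (\<lambda>x. r * (\<Sum>a | sum a UNIV \<le> j. c a * (\<Prod>i\<in>UNIV. x $ i ^ a i))) =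
    (\<lambda>x. \<Sum>a | sum a UNIV \<le> j. d a * (\<Prod>i\<in>UNIV. x $ i ^ a i))"
    by (intro exI[of _ "\<lambda>a. r * c a"]) (simp add: sum_distrib_left mult.assoc)
qed

lemma polys_zero: "(\<lambda>x. 0) \<in> polys j"
  unfolding polys_def by (auto intro!: exI[of _ "\<lambda>_. 0"])

lemma polys_sum: "(\<And>i. i \<in> I \<Longrightarrow> p i \<in> polys j) \<Longrightarrow> (\<lambda>x. \<Sum>i\<in>I. p i x) \<in> polys j"
  by (induction I rule: infinite_finite_induct) (auto intro: polys_zero polys_add)

lemma poly_on_sum:
  "(\<And>i. i \<in> I \<Longrightarrow> poly_on j S (p i)) \<Longrightarrow> poly_on j S (\<lambda>x. \<Sum>i\<in>I. p i x)"
  unfolding poly_on_def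
proof -
  assume "\<And>i. i \<in> I \<Longrightarrow> \<exists>q\<in>polys j. \<forall>x\<in>S. p i x = q x"
  then obtain q where "\<And>i. i \<in> I \<Longrightarrow> q i \<in> polys j \<and> (\<forall>x\<in>S. p i x = q i x)" by metis
  then show "\<exists>q\<in>polys j. \<forall>x\<in>S. (\<Sum>i\<in>I. p i x) = q x"
    by (intro bexI[of _ "\<lambda>x. \<Sum>i\<in>I. q i x"] ballI sum.cong polys_sum) auto
qed

lemma poly_on_add: "poly_on j S p \<Longrightarrow> poly_on j S q \<Longrightarrow> poly_on j S (\<lambda>x. p x + q x)"
  unfolding poly_on_def using polys_add by fastforce

lemma poly_on_cmult: "poly_on j S p \<Longrightarrow> poly_on j S (\<lambda>x. r * p x)"
  unfolding poly_on_def using polys_cmult by fastforce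

lemma poly_on_subset: "poly_on j S p \<Longrightarrow> T \<subseteq> S \<Longrightarrow> poly_on j T p"
  unfolding poly_on_def by blast

lemma poly_on_inner_const:
  assumes "vpoly_on j S v"
  shows "poly_on j S (\<lambda>x. v x \<bullet> n)"
  using assms unfolding vpoly_on_def inner_vec_def
  by (auto simp: mult.commute[of _ "n $ _"] intro!: poly_on_sum poly_on_cmult)

text \<open>Termwise differentiation of monomials. The derivative comes with explicit coefficients
  \<open>D\<close>, so that partial derivatives are again recognised as polynomials. For
  \<open>j = 0\<close> the truncated \<open>j - 1\<close> is harmless, because the coefficients
  constructed here are then all zero.\<close>

lemma polys_derivative:
  fixes p :: "real^'d \<Rightarrow> real"
  assumes "p \<in> polys j"
  obtains D where "\<And>i. D i \<in> polys (j - 1)"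
    and "\<And>x. (p has_derivative (\<lambda>h. \<Sum>i\<in>UNIV. D i x * h $ i)) (at x)"
proof -
  obtain c where c: "p = (\<lambda>x. \<Sum>a | sum a UNIV \<le> j. c a * (\<Prod>i\<in>UNIV. x $ i ^ a i))"
    using assms unfolding polys_def by auto
  define M where "M a i x = real (a i) * (x $ i ^ (a i - 1) * (\<Prod>l\<in>UNIV-{i}. x $ l ^ a l))"
    for a :: "'d \<Rightarrow> nat" and i and x :: "real^'d"
  define D where "D i x = (\<Sum>a | sum a UNIV \<le> j. c a * M a i x)" for i x
  have M: "M a i \<in> polys (j - 1)" if "sum a UNIV \<le> j" for a i
  \<comment> \<open>For \<open>a i = 0\<close> truncated subtraction leaves the exponent as it is,
    so the degree does not drop; the factor \<open>a i\<close> makes the term zero instead.\<close>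
  proof (cases "a i = 0")
    case True
    then show ?thesis using polys_zero by (simp add: M_def[abs_def])
  next
    case False
    let ?b = "a(i := a i - 1)"
    have "sum a UNIV = a i + sum a (UNIV - {i})" "sum ?b UNIV = ?b i + sum ?b (UNIV - {i})"
      by (rule sum.remove; simp)+
    moreover have "sum ?b (UNIV - {i}) = sum a (UNIV - {i})" by (intro sum.cong) auto
    ultimately have "sum ?b UNIV \<le> j - 1" using False that by simp
    from polys_cmult[OF polys_monomial[OF this]]
    have "(\<lambda>x::real^'d. real (a i) * (\<Prod>l\<in>UNIV. x $ l ^ ?b l)) \<in> polys (j - 1)" .
    also have "(\<lambda>x::real^'d. real (a i) * (\<Prod>l\<in>UNIV. x $ l ^ ?b l)) = M a i"
    proof
      fix x :: "real^'d"
      have "(\<Prod>l\<in>UNIV. x $ l ^ ?b l) = x $ i ^ ?b i * (\<Prod>l\<in>UNIV-{i}. x $ l ^ ?b l)"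
        by (rule prod.remove) auto
      moreover have "(\<Prod>l\<in>UNIV-{i}. x $ l ^ ?b l) = (\<Prod>l\<in>UNIV-{i}. x $ l ^ a l)"
        by (intro prod.cong) auto
      ultimately show "real (a i) * (\<Prod>l\<in>UNIV. x $ l ^ ?b l) = M a i x" by (simp add: M_def)
    qed
    finally show ?thesis .
  qed
  show thesis
  proof
    show "D i \<in> polys (j - 1)" for i
      unfolding D_def by (intro polys_sum polys_cmult M) auto
    fix x :: "real^'d"
    have 1: "((\<lambda>x. x $ i ^ n) has_derivative (\<lambda>h. real n * (h $ i) * x $ i ^ (n - 1))) (at x)" for i n
      by (rule has_derivative_power[OF bounded_linear_imp_has_derivative[OF bounded_linear_vec_nth]])
    have "(p has_derivative (\<lambda>h. \<Sum>a | sum a UNIV \<le> j. c a *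
        (\<Sum>i\<in>UNIV. real (a i) * (h $ i) * x $ i ^ (a i - 1) * (\<Prod>l\<in>UNIV-{i}. x $ l ^ a l)))) (at x)"
      unfolding c by (intro has_derivative_sum has_derivative_mult_right has_derivative_prod 1)
    also have "(\<lambda>h. \<Sum>a | sum a UNIV \<le> j. c a *
        (\<Sum>i\<in>UNIV. real (a i) * (h $ i) * x $ i ^ (a i - 1) * (\<Prod>l\<in>UNIV-{i}. x $ l ^ a l))) =
        (\<lambda>h. \<Sum>i\<in>UNIV. D i x * h $ i)"
    proof
      fix h :: "real^'d"
      show "(\<Sum>a | sum a UNIV \<le> j. c a *
        (\<Sum>i\<in>UNIV. real (a i) * (h $ i) * x $ i ^ (a i - 1) * (\<Prod>l\<in>UNIV-{i}. x $ l ^ a l))) =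
        (\<Sum>i\<in>UNIV. D i x * h $ i)"
        unfolding D_def sum_distrib_right sum_distrib_left
        by (subst sum.swap) (auto simp: M_def mult_ac intro!: sum.cong)
    qed
    finally show "(p has_derivative (\<lambda>h. \<Sum>i\<in>UNIV. D i x * h $ i)) (at x)" .
  qed
qed

lemma continuous_on_polys: "p \<in> polys j \<Longrightarrow> continuous_on S p"
proof -
  assume "p \<in> polys j"
  then obtain D where "\<And>x. (p has_derivative (\<lambda>h. \<Sum>i\<in>UNIV. D i x * h $ i)) (at x)"
    by (rule polys_derivative) blast
  then have "isCont p x" for x by (rule has_derivative_continuous)
  then show ?thesis by (rule continuous_at_imp_continuous_on[OF ballI])
qed

lemma continuous_on_poly_on: "poly_on j S p \<Longrightarrow> continuous_on S p"
  unfolding poly_on_def by (metis continuous_on_cong continuous_on_polys)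

text \<open>Restricted to the segment from \<open>x\<close> to a point \<open>y\<close> of
  \<open>S\<close>, the derivative is that of a function of one variable, so \<open>A\<close> and
  \<open>B\<close> agree on \<open>y - x\<close>. Differences of such vectors, with \<open>y\<close>
  in a ball inside \<open>S\<close>, give every direction up to scaling.\<close>

lemma has_derivative_within_convex_unique:
  fixes f :: "'a::euclidean_space \<Rightarrow> 'b::real_normed_vector"
  assumes S: "convex S" "interior S \<noteq> {}" "x \<in> S"
    and A: "(f has_derivative A) (at x within S)" and B: "(f has_derivative B) (at x within S)"
  shows "A = B"
proof -
  have lin: "linear A" "linear B"
    using A B has_derivative_linear by auto
  have eq: "A (y - x) = B (y - x)" if "y \<in> S" for y
  proof -
    have sub: "(\<lambda>t. x + t *\<^sub>R (y - x)) ` {0..1} \<subseteq> S"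
      using S that by (auto simp: convex_alt algebra_simps)
    have "((\<lambda>t. f (x + t *\<^sub>R (y - x))) has_vector_derivative F (y - x)) (at 0 within {0..1})"
      if "(f has_derivative F) (at x within S)" for F
    proof -
      have l: "linear F" using that has_derivative_linear by blast
      have "(f has_derivative F) (at (x + 0 *\<^sub>R (y - x)) within (\<lambda>t. x + t *\<^sub>R (y - x)) ` {0..1})"
        using has_derivative_subset[OF that sub] by simp
      moreover have "((\<lambda>t. x + t *\<^sub>R (y - x)) has_derivative (\<lambda>t. t *\<^sub>R (y - x))) (at (0::real) within {0..1})"
        by (auto intro!: derivative_eq_intros)
      ultimately have "((\<lambda>t. f (x + t *\<^sub>R (y - x))) has_derivative (\<lambda>t. F (t *\<^sub>R (y - x)))) (at (0::real) within {0..1})"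
        using has_derivative_in_compose by blast
      then show ?thesis
        by (simp add: has_vector_derivative_def linear_scale[OF l])
    qed
    from this[OF A] this[OF B] show ?thesis
      using vector_derivative_unique_within[of 0 "{0..1::real}"]
      by (metis atLeastAtMost_iff trivial_limit_within islimpt_Icc order_refl zero_le_one zero_less_one)
  qed
  obtain y r where y: "r > 0" "ball y r \<subseteq> S"
    using S(2) by (meson all_not_in_conv mem_interior)
  show ?thesis
  proof
    fix h :: 'a
    have pos: "norm h + 1 > 0" by (rule add_nonneg_pos) auto
    \<comment> \<open>Chosen so that \<open>y + s *\<^sub>R h\<close> stays in the ball around
      \<open>y\<close>; the added 1 covers \<open>h = 0\<close>.\<close>
    define s where "s = r / (norm h + 1)"
    have s: "s > 0" unfolding s_def by (rule divide_pos_pos[OF y(1) pos])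
    have "norm (s *\<^sub>R h) = r * norm h / (norm h + 1)"
      using y(1) pos by (simp add: s_def)
    also have "\<dots> < r"
      using y(1) pos by (simp add: pos_divide_less_eq distrib_left)
    finally have "norm (s *\<^sub>R h) < r" .
    then have "y + s *\<^sub>R h \<in> S" "y \<in> S"
      using y by (auto simp: subset_iff dist_norm)
    from this[THEN eq] have "A ((y + s *\<^sub>R h - x) - (y - x)) = B ((y + s *\<^sub>R h - x) - (y - x))"
      by (simp only: linear_diff[OF lin(1)] linear_diff[OF lin(2)])
    then show "A h = B h"
      using s lin by (simp add: linear_scale)
  qed
qed

text \<open>\<open>frechet_derivative\<close> chooses some derivative within \<open>S\<close>.
  Uniqueness pins the choice down, at boundary points too, so agreement with \<open>p\<close> on
  \<open>S\<close> alone suffices.\<close>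

lemma partial_on_poly:
  fixes f :: "real^'d \<Rightarrow> real"
  assumes S: "convex S" "interior S \<noteq> {}" "x \<in> S"
    and f: "\<And>y. y \<in> S \<Longrightarrow> f y = p y"
    and p: "(p has_derivative (\<lambda>h. \<Sum>i\<in>UNIV. D i x * h $ i)) (at x)"
  shows "partial_on S l f x = D l x"
proof -
  have "(f has_derivative (\<lambda>h. \<Sum>i\<in>UNIV. D i x * h $ i)) (at x within S)"
    using has_derivative_transform[OF S(3) f has_derivative_at_withinI[OF p]] by blast
  then have "frechet_derivative f (at x within S) = (\<lambda>h. \<Sum>i\<in>UNIV. D i x * h $ i)"
    using has_derivative_within_convex_unique[OF S] frechet_derivative_works differentiable_def by blast
  then show ?thesis
    by (simp add: partial_on_def axis_def if_distrib[of "\<lambda>t. _ * t"] cong: if_cong)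
qed

subsection \<open>Integrals of continuous functions over compact sets\<close>

lemma absolutely_integrable_continuous_compact:
  fixes f :: "'a::euclidean_space \<Rightarrow> 'b::euclidean_space"
  assumes "compact S" "continuous_on S f"
  shows "f absolutely_integrable_on S"
proof -
  have "integrable lborel (\<lambda>x. indicator S x *\<^sub>R f x)"
    by (rule borel_integrable_compact[OF assms])
  then show ?thesis
    unfolding set_integrable_def by (metis borel_measurable_integrable integrable_completion)
qed

lemma set_integral_continuous_compact:
  fixes f :: "'a::euclidean_space \<Rightarrow> 'b::euclidean_space"
  assumes "compact S" "continuous_on S f"
  shows "(LINT x:S|lebesgue. f x) = integral S f"
  by (intro set_lebesgue_integral_eq_integral absolutely_integrable_continuous_compact assms)

lemma integrable_continuous_compact:
  fixes f :: "'a::euclidean_space \<Rightarrow> 'b::euclidean_space"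
  assumes "compact S" "continuous_on S f"
  shows "f integrable_on S"
  using absolutely_integrable_continuous_compact[OF assms] set_lebesgue_integral_eq_integral(1) by blast

text \<open>A convex body is the closure of its interior and its frontier is a null set. Vanishing
  on the interior, an open set of positive measure, therefore extends by continuity to the
  boundary.\<close>

lemma integral_eq_0_imp_eq_0:
  fixes f :: "'a::euclidean_space \<Rightarrow> real"
  assumes S: "compact S" "convex S" "interior S \<noteq> {}" and f: "continuous_on S f"
    and nonneg: "\<And>x. x \<in> S \<Longrightarrow> 0 \<le> f x" and int: "integral S f = 0" and x: "x \<in> S"
  shows "f x = 0"
proof -
  have cl: "closure (interior S) = S"
    using convex_closure_interior[OF S(2,3)] S(1) by (simp add: compact_imp_closed)
  have fr: "S - interior S = frontier S"
    using S(1) by (simp add: frontier_def compact_imp_closed)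
  have null: "emeasure lborel (S - interior S) = 0"
    unfolding fr using negligible_convex_frontier[OF S(2)] S(1)
    by (simp add: negligible_iff_emeasure0 compact_frontier compact_imp_closed)
  have meas: "S \<in> sets lborel" "interior S \<in> sets lborel"
    using S(1) by (auto intro: borel_compact)
  have eq: "emeasure lborel S = emeasure lborel (interior S)"
    using emeasure_Un_null_set[of "interior S" lborel "S - interior S"] meas null interior_subset[of S]
    by (metis Un_Diff_cancel null_setsI sets.Diff sup.absorb2)
  show ?thesis
  proof (rule has_integral_0_closure_imp_0[of "interior S"])
    show "emeasure lborel (interior S) < \<infinity>"
      unfolding eq[symmetric] using emeasure_bounded_finite[OF compact_imp_bounded[OF S(1)]] by simp
    show "0 < emeasure lborel (interior S)"
      using open_not_negligible[OF open_interior S(3)]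
      by (simp add: negligible_iff_emeasure0 zero_less_iff_neq_zero)
    show "(f has_integral 0) (closure (interior S))"
      unfolding cl using integrable_continuous_compact[OF S(1) f] int by (metis integrable_integral)
  qed (use f nonneg eq x interior_subset[of S] in \<open>auto simp: cl\<close>)
qed

subsection \<open>Facets of a polytope\<close>

text \<open>A set of dimension one less than the space affinely spans the whole hyperplane with
  normal \<open>n\<close>. The component of \<open>w\<close> orthogonal to \<open>n\<close> is a
  direction of that hyperplane, hence orthogonal to \<open>w\<close>, hence zero. This determines
  normals up to a factor.\<close>

lemma orthogonal_to_hyperplane_piece:
  fixes e :: "'a::euclidean_space set"
  assumes e: "aff_dim e = int DIM('a) - 1" "e \<noteq> {}"
    and n: "norm n = 1" "\<And>x y. x \<in> e \<Longrightarrow> y \<in> e \<Longrightarrow> n \<bullet> (y - x) = 0"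
    and w: "\<And>x y. x \<in> e \<Longrightarrow> y \<in> e \<Longrightarrow> w \<bullet> (y - x) = 0"
  shows "w = (w \<bullet> n) *\<^sub>R n"
proof -
  obtain x where x: "x \<in> e" using e by blast
  have sub: "affine hull e \<subseteq> {y. a \<bullet> y = a \<bullet> x}" if "\<And>y. y \<in> e \<Longrightarrow> a \<bullet> (y - x) = 0" for a
    using that by (intro hull_minimal affine_hyperplane) (auto simp: inner_diff_right)
  have "affine hull e = {y. n \<bullet> y = n \<bullet> x}"
  proof (rule affine_dim_equal)
    show "aff_dim (affine hull e) = aff_dim {y. n \<bullet> y = n \<bullet> x}"
      using n(1) e(1) by (subst aff_dim_hyperplane) auto
  qed (use sub n(2) x e in \<open>auto simp: affine_hyperplane\<close>)
  moreover define u where "u = w - (w \<bullet> n) *\<^sub>R n"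
  moreover have nn: "n \<bullet> n = 1" using n(1) by (simp add: norm_eq_1)
  then have nu: "n \<bullet> u = 0" by (simp add: u_def inner_diff_right inner_commute)
  ultimately have "x + u \<in> affine hull e" by (simp add: inner_add_right)
  then have "w \<bullet> u = 0" using sub[of w] w x by (auto simp: inner_add_right)
  then have "u \<bullet> u = 0" using nu by (simp add: u_def inner_diff_left)
  then show ?thesis by (simp add: u_def)
qed

locale solid_polytope =
  fixes K :: "'a::euclidean_space set"
  assumes polytope: "polytope K" and interior: "interior K \<noteq> {}"
begin

lemma aff_dim_facet: "e facet_of K \<Longrightarrow> aff_dim e = int DIM('a) - 1"
  using interior by (simp add: facet_of_def aff_dim_nonempty_interior)

lemma facet_nonempty: "e facet_of K \<Longrightarrow> e \<noteq> {}"
  by (simp add: facet_of_def)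

lemma compact_facet: "e facet_of K \<Longrightarrow> compact e"
  by (meson facet_of_imp_face_of face_of_polytope_polytope polytope polytope_imp_compact)

lemma convex_facet: "e facet_of K \<Longrightarrow> convex e"
  by (meson facet_of_imp_face_of face_of_imp_convex)

lemma finite_facets: "finite {e. e facet_of K}"
  using finite_polytope_facets[OF polytope] .

text \<open>Two candidates for the definite description are both orthogonal to the facet, hence
  equal up to sign. Opposite signs would squeeze \<open>K\<close> into a hyperplane, against its
  nonempty interior.\<close>

lemma outward_normalI:
  assumes e: "e facet_of K" and n: "norm n = 1" "\<And>x y. x \<in> e \<Longrightarrow> y \<in> K \<Longrightarrow> n \<bullet> (y - x) \<le> 0"
  shows "outward_normal K e = n"
  unfolding outward_normal_def
proof (rule the_equality)
  fix n' assume n': "norm n' = 1 \<and> (\<forall>x\<in>e. \<forall>y\<in>K. n' \<bullet> (y - x) \<le> 0)"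
  have sub: "e \<subseteq> K" using e by (rule facet_of_imp_subset)
  \<comment> \<open>Both points lie in \<open>K\<close>, so the inequality may also be used with
    \<open>x\<close> and \<open>y\<close> exchanged.\<close>
  have orth: "m \<bullet> (y - x) = 0" if "x \<in> e" "y \<in> e" "\<And>x y. x \<in> e \<Longrightarrow> y \<in> K \<Longrightarrow> m \<bullet> (y - x) \<le> 0" for x y m
    using that(3)[of x y] that(3)[of y x] that(1,2) sub by (force simp: inner_diff_right)
  have eq: "n' = (n' \<bullet> n) *\<^sub>R n"
    by (rule orthogonal_to_hyperplane_piece[OF aff_dim_facet[OF e] facet_nonempty[OF e]])
      (use n n' orth in blast)+
  then have "\<bar>n' \<bullet> n\<bar> = 1" using n n' by (metis mult.right_neutral norm_scaleR)
  then consider "n' = n" | "n' = - n" using eq by (auto simp: abs_if split: if_splits)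
  then show "n' = n"
  proof cases
    case 2
    obtain x where x: "x \<in> e" using facet_nonempty[OF e] by blast
    have "n \<bullet> y = n \<bullet> x" if "y \<in> K" for y
      using n(2)[OF x that] n' x that 2 by (force simp: inner_diff_right)
    then have "K \<subseteq> {y. n \<bullet> y = n \<bullet> x}" by auto
    then have "interior K \<subseteq> interior {y. n \<bullet> y = n \<bullet> x}" by (rule interior_mono)
    moreover have "n \<noteq> 0" using n(1) by auto
    ultimately show ?thesis using interior by (simp add: interior_hyperplane)
  qed
qed (use n in blast)

text \<open>The right-hand side of the half-space inequality belonging to the facet. The chosen
  point is immaterial, since the inner product with the normal is constant on a facet.\<close>

definition offset :: "'a set \<Rightarrow> real" where
  "offset e = outward_normal K e \<bullet> (SOME x. x \<in> e)"

text \<open>All three claims come from one minimal representation of \<open>K\<close> by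
  half-spaces. Nonempty interior makes the affine hull the whole space. By minimality the facets are
  exactly the sections of \<open>K\<close> by the bounding hyperplanes, and normalising the
  coefficients gives outward normals and offsets.\<close>

lemma norm_outward_normal: "e facet_of K \<Longrightarrow> norm (outward_normal K e) = 1"
  and facet_eq: "e facet_of K \<Longrightarrow> e = K \<inter> {x. outward_normal K e \<bullet> x = offset e}"
  and polytope_eq: "K = {x. \<forall>e. e facet_of K \<longrightarrow> outward_normal K e \<bullet> x \<le> offset e}"
proof -
  have "polyhedron K" using polytope by (rule polytope_imp_polyhedron)
  then obtain F where F: "finite F" "K = affine hull K \<inter> \<Inter>F"
    "\<forall>h\<in>F. \<exists>a b. a \<noteq> 0 \<and> h = {x. a \<bullet> x \<le> b}"
    "\<And>F'. F' \<subset> F \<Longrightarrow> K \<subset> affine hull K \<inter> \<Inter>F'"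
    unfolding polyhedron_Int_affine_minimal by meson
  then obtain a b where ab: "\<And>h. h \<in> F \<Longrightarrow> a h \<noteq> 0 \<and> h = {x. a h \<bullet> x \<le> b h}" by metis
  have facet: "e facet_of K \<longleftrightarrow> (\<exists>h. h \<in> F \<and> e = K \<inter> {x. a h \<bullet> x = b h})" for e
    by (rule facet_of_polyhedron_explicit[OF F(1,2) ab F(4)])
  have "affine hull K = UNIV" using interior by (rule affine_hull_nonempty_interior)
  with F(2) have K: "K = \<Inter>F" by simp
  have le: "a h \<bullet> x \<le> b h" if "h \<in> F" "x \<in> K" for h x
    using that ab[of h] K by blast
  have normal: "outward_normal K e = a h /\<^sub>R norm (a h) \<and> offset e = b h / norm (a h)"
    if h: "h \<in> F" and e: "e = K \<inter> {x. a h \<bullet> x = b h}" for e h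
  proof -
    have ef: "e facet_of K" using h e facet by blast
    have pos: "norm (a h) > 0" using ab[OF h] by simp
    have "outward_normal K e = a h /\<^sub>R norm (a h)"
    proof (rule outward_normalI[OF ef])
      fix x y assume "x \<in> e" "y \<in> K"
      then have "a h \<bullet> (y - x) \<le> 0" using le[OF h] e by (simp add: inner_diff_right)
      then show "(a h /\<^sub>R norm (a h)) \<bullet> (y - x) \<le> 0"
        using pos by (simp add: mult_nonneg_nonpos divide_nonpos_pos)
    qed (use pos in simp)
    moreover have "(SOME x. x \<in> e) \<in> e" using facet_nonempty[OF ef] by (simp add: some_in_eq)
    then have "a h \<bullet> (SOME x. x \<in> e) = b h" using e by blast
    ultimately show ?thesis by (simp add: offset_def divide_inverse mult.commute)
  qed
  show "norm (outward_normal K e) = 1" if "e facet_of K"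
    using that ab normal facet by (force simp: norm_inverse)
  show "e = K \<inter> {x. outward_normal K e \<bullet> x = offset e}" if ef: "e facet_of K"
  proof -
    obtain h where h: "h \<in> F" "e = K \<inter> {x. a h \<bullet> x = b h}" using facet ef by blast
    then have "norm (a h) \<noteq> 0" using ab by simp
    then have "(outward_normal K e \<bullet> x = offset e) = (a h \<bullet> x = b h)" for x
      using normal[OF h] by (simp add: field_simps)
    then show ?thesis using h(2) by blast
  qed
  show "K = {x. \<forall>e. e facet_of K \<longrightarrow> outward_normal K e \<bullet> x \<le> offset e}" (is "_ = ?R")
  proof -
    have *: "(outward_normal K (K \<inter> {x. a h \<bullet> x = b h}) \<bullet> x \<le> offset (K \<inter> {x. a h \<bullet> x = b h})) = (a h \<bullet> x \<le> b h)"
      if "h \<in> F" for x h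
      using normal[OF that refl] ab[OF that] by (simp add: field_simps)
    have "x \<in> ?R \<longleftrightarrow> (\<forall>h\<in>F. a h \<bullet> x \<le> b h)" for x
      unfolding facet using * by auto
    moreover have "x \<in> \<Inter>F \<longleftrightarrow> (\<forall>h\<in>F. a h \<bullet> x \<le> b h)" for x using ab by blast
    ultimately show ?thesis using K by blast
  qed
qed

text \<open>\<open>facet_normal\<close> is chosen from \<open>e\<close> alone and does not know on
  which side \<open>K\<close> lies, so only the sign is left open.\<close>

lemma facet_normal_cases:
  assumes e: "e facet_of K"
  shows "facet_normal e = outward_normal K e \<or> facet_normal e = - outward_normal K e"
    and "norm (facet_normal e) = 1"
    and "x \<in> e \<Longrightarrow> y \<in> e \<Longrightarrow> facet_normal e \<bullet> (y - x) = 0"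
proof -
  have "outward_normal K e \<bullet> z = offset e" if "z \<in> e" for z
    using that facet_eq[OF e] by blast
  then have 1: "norm (outward_normal K e) = 1 \<and> (\<forall>x\<in>e. \<forall>y\<in>e. outward_normal K e \<bullet> (y - x) = 0)"
    using norm_outward_normal[OF e] by (auto simp: inner_diff_right)
  then have 2: "norm (facet_normal e) = 1 \<and> (\<forall>x\<in>e. \<forall>y\<in>e. facet_normal e \<bullet> (y - x) = 0)"
    unfolding facet_normal_def by (rule someI)
  then show "norm (facet_normal e) = 1" "x \<in> e \<Longrightarrow> y \<in> e \<Longrightarrow> facet_normal e \<bullet> (y - x) = 0"
    by blast+
  have eq: "facet_normal e = (facet_normal e \<bullet> outward_normal K e) *\<^sub>R outward_normal K e" (is "_ = ?r *\<^sub>R _")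
    by (rule orthogonal_to_hyperplane_piece[OF aff_dim_facet[OF e] facet_nonempty[OF e]])
      (use 1 2 in blast)+
  then have "\<bar>?r\<bar> = 1" using 1 2 by (metis mult.right_neutral norm_scaleR)
  then show "facet_normal e = outward_normal K e \<or> facet_normal e = - outward_normal K e"
    using eq by (auto simp: abs_if split: if_splits)
qed

end

subsection \<open>Sweeping a polytope\<close>

definition sweep :: "'a::euclidean_space \<Rightarrow> real \<Rightarrow> 'a set \<Rightarrow> 'a set" where
  "sweep v t S = {x + s *\<^sub>R v | x s. x \<in> S \<and> 0 \<le> s \<and> s \<le> t}"

lemma sweep_image: "sweep v t S = (\<lambda>(x, s). x + s *\<^sub>R v) ` (S \<times> {0..t})"
  unfolding sweep_def by force

lemma compact_sweep: "compact S \<Longrightarrow> compact (sweep v t S)"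
  unfolding sweep_image case_prod_beta
  by (intro compact_continuous_image compact_Times continuous_intros) auto

lemma convex_sweep: "convex S \<Longrightarrow> convex (sweep v t S)"
  unfolding sweep_image case_prod_beta
  by (intro convex_linear_image convex_Times)
    (auto intro!: linearI simp: algebra_simps)

lemma facet_prism_eq_sweep: "facet_prism e = sweep (facet_normal e) 1 e"
  unfolding facet_prism_def sweep_def ..

section \<open>Decomposition of a swept polytope\<close>

context solid_polytope
begin

text \<open>The facets through which \<open>v\<close> leaves \<open>K\<close>; those through which
  it enters are \<open>outflow (- v)\<close>. Facets parallel to \<open>v\<close> belong to neither:
  their sweeps stay inside their hyperplanes.\<close>

definition outflow :: "'a \<Rightarrow> 'a set set" where
  "outflow v = {e. e facet_of K \<and> outward_normal K e \<bullet> v > 0}"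

lemma finite_outflow: "finite (outflow v)"
  using finite_facets unfolding outflow_def by simp

lemma compact_polytope: "compact K"
  using polytope by (rule polytope_imp_compact)

lemma facet_subset: "e facet_of K \<Longrightarrow> e \<subseteq> K"
  by (rule facet_of_imp_subset)

lemma inner_le_offset: "e facet_of K \<Longrightarrow> x \<in> K \<Longrightarrow> outward_normal K e \<bullet> x \<le> offset e"
  using polytope_eq by blast

lemma inner_eq_offset: "e facet_of K \<Longrightarrow> x \<in> e \<Longrightarrow> outward_normal K e \<bullet> x = offset e"
  using facet_eq[of e] by blast

text \<open>If \<open>x + s *\<^sub>R v\<close> lies outside \<open>K\<close>, the ray from
  \<open>x\<close> has left \<open>K\<close> before time \<open>s\<close>. Its exit point lies on an
  outflow facet, and the rest of the path lies in the sweep of that facet.\<close>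

lemma sweep_eq_Un_outflow:
  assumes "t \<ge> 0"
  shows "sweep v t K = K \<union> (\<Union>e\<in>outflow v. sweep v t e)"
proof
  show "K \<union> (\<Union>e\<in>outflow v. sweep v t e) \<subseteq> sweep v t K"
  proof (intro Un_least UN_least)
    show "K \<subseteq> sweep v t K"
      using assms unfolding sweep_def by (force intro: exI[of _ "0::real"])
    show "sweep v t e \<subseteq> sweep v t K" if "e \<in> outflow v" for e
      using that facet_subset unfolding sweep_def outflow_def by blast
  qed
  show "sweep v t K \<subseteq> K \<union> (\<Union>e\<in>outflow v. sweep v t e)"
  proof
    fix z assume "z \<in> sweep v t K"
    then obtain x s where z: "z = x + s *\<^sub>R v" "x \<in> K" "0 \<le> s" "s \<le> t" unfolding sweep_def by blast
    show "z \<in> K \<union> (\<Union>e\<in>outflow v. sweep v t e)"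
    proof (cases "z \<in> K")
      case False
      let ?n = "outward_normal K"
      \<comment> \<open>The time at which the ray from \<open>x\<close> reaches the hyperplane of
        \<open>e\<close>.\<close>
      define \<rho> where "\<rho> e = (offset e - ?n e \<bullet> x) / (?n e \<bullet> v)" for e
      obtain e0 where e0: "e0 facet_of K" "?n e0 \<bullet> z > offset e0"
        using False by (subst (asm) polytope_eq) (auto simp: not_le)
      have "s * (?n e0 \<bullet> v) > offset e0 - ?n e0 \<bullet> x" using e0 z by (simp add: inner_add_right)
      moreover have "offset e0 - ?n e0 \<bullet> x \<ge> 0" using inner_le_offset[OF e0(1) z(2)] by simp
      ultimately have "?n e0 \<bullet> v > 0" using z(3) by (smt (verit) mult_nonneg_nonpos)
      then have e0': "e0 \<in> outflow v" "\<rho> e0 < s"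
        using e0 \<open>s * _ > _\<close> by (auto simp: outflow_def \<rho>_def field_simps)
      \<comment> \<open>At the earliest crossing time no other outflow inequality is violated yet,
        and the remaining inequalities only get slacker or stay equal along \<open>v\<close>. Hence
        the point reached is still in \<open>K\<close>.\<close>
      obtain e where e: "e \<in> outflow v" "\<And>e'. e' \<in> outflow v \<Longrightarrow> \<rho> e \<le> \<rho> e'"
        using finite_outflow[of v] e0'(1) by (metis arg_min_if_finite(1) arg_min_least empty_iff)
      have ef: "e facet_of K" "?n e \<bullet> v > 0" using e(1) by (auto simp: outflow_def)
      have \<rho>: "0 \<le> \<rho> e" "\<rho> e \<le> s"
        using e0' e(2)[of e0] ef inner_le_offset[OF ef(1) z(2)] by (auto simp: \<rho>_def)
      define y where "y = x + \<rho> e *\<^sub>R v"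
      have "?n e' \<bullet> y \<le> offset e'" if e': "e' facet_of K" for e'
      proof (cases "?n e' \<bullet> v > 0")
        case True
        then have "\<rho> e \<le> \<rho> e'" using e' e(2) by (simp add: outflow_def)
        then show ?thesis using True by (simp add: \<rho>_def[of e'] y_def inner_add_right field_simps)
      next
        case False
        then have "\<rho> e * (?n e' \<bullet> v) \<le> 0" using \<rho> by (simp add: mult_nonneg_nonpos)
        then show ?thesis using inner_le_offset[OF e' z(2)] by (simp add: y_def inner_add_right)
      qed
      then have "y \<in> K" using polytope_eq by blast
      moreover have "?n e \<bullet> y = offset e" using ef by (simp add: \<rho>_def y_def inner_add_right)
      ultimately have "y \<in> e" using facet_eq[OF ef(1)] by blast
      moreover have "z = y + (s - \<rho> e) *\<^sub>R v" by (simp add: z y_def algebra_simps)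
      ultimately have "z \<in> sweep v t e"
        using \<rho> z unfolding sweep_def by (auto intro!: exI[of _ y] exI[of _ "s - \<rho> e"])
      then show ?thesis using e(1) by blast
    qed simp
  qed
qed

text \<open>The sweep lies on the outer side of the facet's hyperplane and \<open>K\<close> on the
  inner side, so they meet only within the hyperplane.\<close>

lemma negligible_Int_sweep:
  assumes "e \<in> outflow v"
  shows "negligible (K \<inter> sweep v t e)"
proof (rule negligible_subset)
  let ?n = "outward_normal K e"
  have e: "e facet_of K" "?n \<bullet> v > 0" using assms by (auto simp: outflow_def)
  show "negligible {x. ?n \<bullet> x = offset e}"
    using e by (intro negligible_hyperplane) auto
  show "K \<inter> sweep v t e \<subseteq> {x. ?n \<bullet> x = offset e}"
  proof
    fix z assume z: "z \<in> K \<inter> sweep v t e"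
    then obtain y s where y: "z = y + s *\<^sub>R v" "y \<in> e" "0 \<le> s" unfolding sweep_def by blast
    have "s * (?n \<bullet> v) \<ge> 0" using e y by simp
    then show "z \<in> {x. ?n \<bullet> x = offset e}"
      using inner_le_offset[OF e(1), of z] inner_eq_offset[OF e(1) y(2)] z y(1)
      by (simp add: inner_add_right)
  qed
qed

lemma negligible_sweep_Int_sweep:
  assumes "e \<in> outflow v" "e' \<in> outflow v" "e \<noteq> e'"
  shows "negligible (sweep v t e \<inter> sweep v t e')"
proof (rule negligible_subset)
  let ?n = "outward_normal K e" and ?n' = "outward_normal K e'"
  have e: "e facet_of K" "?n \<bullet> v > 0" and e': "e' facet_of K" "?n' \<bullet> v > 0"
    using assms by (auto simp: outflow_def)
  \<comment> \<open>Eliminating \<open>s\<close> from the two equations for the inner products of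
    \<open>z = y + s *\<^sub>R v\<close> with both normals leaves the hyperplane
    \<open>w \<bullet> z = c\<close>.\<close>
  define w where "w = (?n' \<bullet> v) *\<^sub>R ?n - (?n \<bullet> v) *\<^sub>R ?n'"
  define c where "c = (?n' \<bullet> v) * offset e - (?n \<bullet> v) * offset e'"
  \<comment> \<open>Otherwise the two unit normals coincide. Each facet lies in the half-space of
    the other, so the offsets coincide as well, and with them the facets.\<close>
  have "w \<noteq> 0"
  proof
    assume "w = 0"
    then have eq: "(?n' \<bullet> v) *\<^sub>R ?n = (?n \<bullet> v) *\<^sub>R ?n'" by (simp add: w_def)
    then have "norm ((?n' \<bullet> v) *\<^sub>R ?n) = norm ((?n \<bullet> v) *\<^sub>R ?n')" by simp
    then have "?n' \<bullet> v = ?n \<bullet> v"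
      using e e' norm_outward_normal[of e] norm_outward_normal[of e'] by simp
    with eq have "(?n \<bullet> v) *\<^sub>R ?n = (?n \<bullet> v) *\<^sub>R ?n'" by metis
    then have n: "?n = ?n'" using e(2) by (metis less_irrefl scaleR_cancel_left)
    obtain x x' where x: "x \<in> e" "x' \<in> e'"
      using facet_nonempty[OF e(1)] facet_nonempty[OF e'(1)] by blast
    have "x \<in> K" "x' \<in> K" using x facet_subset[OF e(1)] facet_subset[OF e'(1)] by blast+
    then have "?n \<bullet> x' \<le> offset e" "?n' \<bullet> x \<le> offset e'"
      using inner_le_offset[OF e(1)] inner_le_offset[OF e'(1)] by blast+
    moreover have "?n \<bullet> x = offset e" "?n' \<bullet> x' = offset e'"
      using inner_eq_offset[OF e(1)] inner_eq_offset[OF e'(1)] x by blast+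
    ultimately have "offset e = offset e'" unfolding n by linarith
    then have "e = e'" using facet_eq[OF e(1)] facet_eq[OF e'(1)] n by metis
    with assms show False by simp
  qed
  then show "negligible {x. w \<bullet> x = c}" by (intro negligible_hyperplane) auto
  show "sweep v t e \<inter> sweep v t e' \<subseteq> {x. w \<bullet> x = c}"
  proof
    fix z assume "z \<in> sweep v t e \<inter> sweep v t e'"
    then obtain y s y' s' where y: "z = y + s *\<^sub>R v" "y \<in> e" and y': "z = y' + s' *\<^sub>R v" "y' \<in> e'"
      unfolding sweep_def by blast
    have n: "?n \<bullet> z = offset e + s * (?n \<bullet> v)" "?n' \<bullet> z = offset e' + s' * (?n' \<bullet> v)"
      using inner_eq_offset[OF e(1) y(2)] inner_eq_offset[OF e'(1) y'(2)]
      by (simp add: y(1) inner_add_right, simp add: y'(1) inner_add_right)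
    have yK: "y \<in> K" "y' \<in> K" using y y' facet_subset[OF e(1)] facet_subset[OF e'(1)] by blast+
    have yz: "y = z - s *\<^sub>R v" "y' = z - s' *\<^sub>R v" using y y' by (simp_all add: algebra_simps)
    have "?n \<bullet> y' \<le> offset e" "?n' \<bullet> y \<le> offset e'"
      using inner_le_offset[OF e(1)] inner_le_offset[OF e'(1)] yK by blast+
    \<comment> \<open>A point in both sweeps needs the same time from either facet: its starting
      point on one facet satisfies the inequality of the other, which bounds each time by the
      other.\<close>
    then have "s * (?n \<bullet> v) \<le> s' * (?n \<bullet> v)" "s' * (?n' \<bullet> v) \<le> s * (?n' \<bullet> v)"
      using n unfolding yz by (simp_all add: inner_diff_right)
    then have "s = s'" using e e' by simp
    then show "z \<in> {x. w \<bullet> x = c}"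
      using n by (simp add: w_def c_def inner_diff_left algebra_simps)
  qed
qed

lemma integral_sweep_polytope:
  fixes f :: "'a \<Rightarrow> real"
  assumes "t \<ge> 0" and f: "continuous_on UNIV f"
  shows "integral (sweep v t K) f = integral K f + (\<Sum>e\<in>outflow v. integral (sweep v t e) f)"
proof -
  have int: "(f has_integral integral S f) S" if "compact S" for S
    using that f by (meson continuous_on_subset integrable_continuous_compact integrable_integral subset_UNIV)
  have "(f has_integral (integral K f + (\<Sum>e\<in>outflow v. integral (sweep v t e) f)))
      (K \<union> (\<Union>e\<in>outflow v. sweep v t e))"
  proof (intro has_integral_Un has_integral_UN int compact_polytope finite_outflow)
    show "compact (sweep v t e)" if "e \<in> outflow v" for e
      using that by (auto simp: outflow_def intro: compact_sweep compact_facet)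
    show "pairwise (\<lambda>i i'. negligible (sweep v t i \<inter> sweep v t i')) (outflow v)"
      by (auto simp: pairwise_def intro: negligible_sweep_Int_sweep)
    show "negligible (K \<inter> (\<Union>e\<in>outflow v. sweep v t e))"
      unfolding Int_UN_distrib using finite_outflow negligible_Int_sweep
      by (intro negligible_Union) auto
  qed
  then show ?thesis using sweep_eq_Un_outflow[OF assms(1), of v] by (simp add: integral_unique)
qed

end

subsection \<open>Facet prisms\<close>

text \<open>The matrix determinant lemma for the identity plus a rank-one term. Rotating \<nu> to a
  coordinate axis is a similarity, after which the matrix differs from the identity in one column
  only.\<close>

lemma det_rank_one_update:
  fixes \<nu> w :: "real^'d"
  assumes "norm \<nu> = 1"
  shows "det (matrix (\<lambda>x. x + (\<nu> \<bullet> x) *\<^sub>R w)) = 1 + \<nu> \<bullet> w"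
proof -
  obtain k :: 'd where True by simp
  have "norm \<nu> = norm (axis k (1::real))" using assms by simp
  from orthogonal_transformation_exists[OF this]
  obtain R :: "real^'d \<Rightarrow> real^'d" where R: "orthogonal_transformation R" "R \<nu> = axis k 1"
    by blast
  have lR: "linear R" using R(1) by (rule orthogonal_transformation_linear)
  let ?h = "\<lambda>x. x + (\<nu> \<bullet> x) *\<^sub>R w" and ?h' = "\<lambda>y. y + (y $ k) *\<^sub>R R w"
  have lin: "linear ?h" "linear ?h'"
    by (auto intro!: linearI simp: algebra_simps inner_add_right)
  have inner: "\<nu> \<bullet> x = R x $ k" for x
    using R by (metis orthogonal_transformation_def inner_axis' inner_commute mult.left_neutral inner_real_def)
  have "?h' \<circ> R = R \<circ> ?h"
    using lR by (auto simp: fun_eq_iff linear_add linear_scale inner)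
  then have "det (matrix ?h' ** matrix R) = det (matrix R ** matrix ?h)"
    unfolding matrix_compose[OF lR lin(2), symmetric] matrix_compose[OF lin(1) lR, symmetric]
    by (rule arg_cong)
  then have "det (matrix ?h') * det (matrix R) = det (matrix R) * det (matrix ?h)"
    by (simp only: det_mul)
  moreover have "det (matrix R) \<noteq> 0"
    using det_orthogonal_matrix[of "matrix R"] R(1)
    by (auto simp: orthogonal_transformation_matrix)
  ultimately have "det (matrix ?h) = det (matrix ?h')" by simp
  \<comment> \<open>Written as the column replacement of Cramer's rule, applied to the identity
    matrix.\<close>
  also have "matrix ?h' = (\<chi> i j. if j = k then (mat 1 *v (axis k 1 + R w)) $ i else mat 1 $ i $ j)"
    unfolding matrix_vector_mul_lid by (auto simp: vec_eq_iff matrix_def mat_def axis_def)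
  also have "det \<dots> = (axis k 1 + R w) $ k * det (mat 1 :: real^'d^'d)"
    by (rule cramer_lemma)
  also have "\<dots> = 1 + \<nu> \<bullet> w" by (simp add: inner)
  finally show ?thesis .
qed

lemma integral_affine_image:
  fixes h :: "real^'d::{finite,wellorder} \<Rightarrow> real^'d::_" and f :: "real^'d::_ \<Rightarrow> real"
  assumes h: "linear h" "det (matrix h) \<noteq> 0" and S: "compact S" and f: "continuous_on UNIV f"
  shows "integral ((\<lambda>x. h x + c) ` S) f = \<bar>det (matrix h)\<bar> * integral S (\<lambda>x. f (h x + c))"
proof -
  \<comment> \<open>The change of variables formula is stated for values in \<open>real^'n\<close>,
    so \<open>f\<close> passes through \<open>real^1\<close>.\<close>
  let ?g = "\<lambda>x. h x + c" and ?F = "\<lambda>x. vec (f x) :: real^1"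
  have cont: "continuous_on T h" for T
    using h(1) by (simp add: linear_continuous_on linear_linear)
  have cF: "continuous_on T ?F" for T
    unfolding vec_def
    by (intro continuous_on_vec_lambda continuous_on_subset[OF f]) auto
  have comp: "compact (?g ` S)"
    by (intro compact_continuous_image S continuous_intros cont)
  have "integral (?g ` S) ?F = integral S (\<lambda>x. \<bar>det (matrix h)\<bar> *\<^sub>R ?F (?g x))"
  proof (rule integral_change_of_variables)
    show "S \<in> sets lebesgue" using S by (simp add: lmeasurable_compact fmeasurableD)
    show "(?g has_derivative h) (at x within S)" for x
      using h(1) by (auto intro!: derivative_eq_intros linear_imp_has_derivative)
    show "inj_on ?g S"
      using h det_nz_iff_inj[of h] by (auto simp: inj_on_def)
    show "?F absolutely_integrable_on ?g ` S \<or>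
        (\<lambda>x. \<bar>det (matrix h)\<bar> *\<^sub>R ?F (?g x)) absolutely_integrable_on S"
      using absolutely_integrable_continuous_compact[OF comp cF] by blast
  qed
  then have "integral (?g ` S) ?F $ 1 = (\<bar>det (matrix h)\<bar> *\<^sub>R integral S (\<lambda>x. ?F (?g x))) $ 1"
    by simp
  moreover have "integral (?g ` S) ?F $ 1 = integral (?g ` S) f"
    using integral_component_eq_cart[OF integrable_continuous_compact[OF comp cF], of 1] by simp
  moreover have "continuous_on S (\<lambda>x. ?F (?g x))"
    by (rule continuous_on_compose2[OF cF[of UNIV]]) (auto intro!: continuous_intros cont)
  then have "integral S (\<lambda>x. ?F (?g x)) $ 1 = integral S (\<lambda>x. f (?g x))"
    using integral_component_eq_cart[OF integrable_continuous_compact[OF S], of "\<lambda>x. ?F (?g x)" 1] by simp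
  ultimately show ?thesis by simp
qed

text \<open>The signed distance from the hyperplane of a facet \<open>e\<close>. Together with
  \<open>facet_proj\<close> it provides coordinates on the facet prism.\<close>

definition facet_height :: "'a::euclidean_space set \<Rightarrow> 'a \<Rightarrow> real" where
  "facet_height e z = facet_normal e \<bullet> (z - (SOME a. a \<in> e))"

lemma facet_proj_height: "facet_proj e z = z - facet_height e z *\<^sub>R facet_normal e"
  by (simp add: facet_proj_def facet_height_def)

lemma continuous_on_facet_height [continuous_intros]: "continuous_on S (facet_height e)"
  unfolding facet_height_def by (intro continuous_intros)

lemma continuous_on_facet_proj [continuous_intros]: "continuous_on S (facet_proj e)"
  unfolding facet_proj_height by (intro continuous_intros)

section \<open>Integrals over facets as integrals over prisms\<close>

context solid_polytope
begin

lemma facet_prism_point: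
  assumes e: "e facet_of K" and x: "x \<in> e"
  shows "facet_height e (x + s *\<^sub>R facet_normal e) = s"
    and "facet_proj e (x + s *\<^sub>R facet_normal e) = x"
proof -
  have "(SOME a. a \<in> e) \<in> e" using x by (rule someI)
  then have "facet_normal e \<bullet> (x - (SOME a. a \<in> e)) = 0"
    by (rule facet_normal_cases(3)[OF e _ x])
  moreover have "facet_normal e \<bullet> facet_normal e = 1"
    using facet_normal_cases(2)[OF e] by (simp add: norm_eq_1)
  ultimately show *: "facet_height e (x + s *\<^sub>R facet_normal e) = s"
    by (simp add: facet_height_def inner_add_right inner_diff_right)
  show "facet_proj e (x + s *\<^sub>R facet_normal e) = x"
    by (simp add: facet_proj_height *)
qed

lemma facet_proj_in_facet:
  assumes "e facet_of K" "z \<in> facet_prism e"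
  shows "facet_proj e z \<in> e"
  using assms facet_prism_point(2) by (auto simp: facet_prism_def)

lemma compact_facet_prism: "e facet_of K \<Longrightarrow> compact (facet_prism e)"
  by (simp add: facet_prism_eq_sweep compact_sweep compact_facet)

lemma facet_integral_cong:
  assumes "e facet_of K" "\<And>x. x \<in> e \<Longrightarrow> f x = g x"
  shows "facet_integral e f = facet_integral e g"
  unfolding facet_integral_def
  using assms by (intro set_lebesgue_integral_cong)
    (auto simp: facet_proj_in_facet compact_facet_prism lmeasurable_compact fmeasurableD)

lemma facet_integral_eq:
  assumes e: "e facet_of K" and f: "continuous_on e f"
  shows "continuous_on (facet_prism e) (\<lambda>z. f (facet_proj e z))"
    and "facet_integral e f = integral (facet_prism e) (\<lambda>z. f (facet_proj e z))"
proof -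
  show *: "continuous_on (facet_prism e) (\<lambda>z. f (facet_proj e z))"
    by (rule continuous_on_compose2[OF f]) (auto intro: continuous_intros facet_proj_in_facet[OF e])
  show "facet_integral e f = integral (facet_prism e) (\<lambda>z. f (facet_proj e z))"
    unfolding facet_integral_def
    by (rule set_integral_continuous_compact[OF compact_facet_prism[OF e] *])
qed

text \<open>A convex set with empty interior lies in a hyperplane. The normal \<open>a\<close> of
  that hyperplane is constant on \<open>e\<close>, hence a multiple of the facet normal, and also
  constant along the facet normal, hence zero.\<close>

lemma interior_facet_prism:
  assumes e: "e facet_of K"
  shows "interior (facet_prism e) \<noteq> {}"
proof
  assume empty: "interior (facet_prism e) = {}"
  have "convex (facet_prism e)"
    by (simp add: facet_prism_eq_sweep convex_sweep convex_facet e)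
  then obtain a b where a: "a \<noteq> 0" "facet_prism e \<subseteq> {x. a \<bullet> x = b}"
    using empty by (rule empty_interior_subset_hyperplane)
  let ?n = "facet_normal e"
  have in_prism: "x + s *\<^sub>R ?n \<in> facet_prism e" if "x \<in> e" "0 \<le> s" "s \<le> 1" for x s
    using that unfolding facet_prism_def by blast
  have ab: "a \<bullet> x = b" "a \<bullet> (x + ?n) = b" if "x \<in> e" for x
    using in_prism[OF that, of 0] in_prism[OF that, of 1] a(2) by auto
  have "a = (a \<bullet> ?n) *\<^sub>R ?n"
    by (rule orthogonal_to_hyperplane_piece[OF aff_dim_facet[OF e] facet_nonempty[OF e]
          facet_normal_cases(2)[OF e] facet_normal_cases(3)[OF e]])
      (auto simp: inner_diff_right ab)
  moreover obtain x where "x \<in> e" using facet_nonempty[OF e] by blast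
  then have "a \<bullet> ?n = 0" using ab by (simp add: inner_add_right)
  ultimately show False using a(1) by simp
qed

text \<open>Used when a normal velocity jump or difference is tested against itself. The prism is a
  convex body, so the vanishing holds on it pointwise and passes to its base
  \<open>e\<close>.\<close>

lemma facet_integral_square_eq_0:
  assumes e: "e facet_of K" and f: "continuous_on e f"
    and int: "facet_integral e (\<lambda>x. f x * f x) = 0" and x: "x \<in> e"
  shows "f x = 0"
proof -
  have cont: "continuous_on e (\<lambda>x. f x * f x)" by (intro continuous_intros f)
  have "x + 0 *\<^sub>R facet_normal e \<in> facet_prism e"
    using x unfolding facet_prism_def by (intro CollectI exI conjI) auto
  then have "f (facet_proj e (x + 0 *\<^sub>R facet_normal e)) * f (facet_proj e (x + 0 *\<^sub>R facet_normal e)) = 0"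
    using facet_integral_eq[OF e cont] int e
    by (intro integral_eq_0_imp_eq_0[OF compact_facet_prism _ interior_facet_prism,
          where f = "\<lambda>z. f (facet_proj e z) * f (facet_proj e z)"])
      (auto simp: facet_prism_eq_sweep convex_sweep convex_facet)
  then show ?thesis using facet_prism_point(2)[OF e x, of 0] by simp
qed

end

subsection \<open>The divergence theorem for polytopes\<close>

text \<open>An affine map carries the right prism of height one onto the oblique prism swept by
  \<open>e\<close>. Its determinant is \<open>t\<close> times the inner product of \<open>v\<close>
  with the facet normal, whose unknown sign disappears in the absolute value.\<close>

lemma integral_sweep_facet:
  fixes K :: "(real^'d::{finite,wellorder}) set" and f :: "real^'d::_ \<Rightarrow> real"
  assumes K: "solid_polytope K" and e: "e facet_of K" and v: "outward_normal K e \<bullet> v \<noteq> 0"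
    and t: "t > 0" and f: "continuous_on UNIV f"
  shows "integral (sweep v t e) f = t * \<bar>outward_normal K e \<bullet> v\<bar> *
    integral (facet_prism e) (\<lambda>z. f (facet_proj e z + (t * facet_height e z) *\<^sub>R v))"
proof -
  interpret solid_polytope K by (rule K)
  define \<nu> where "\<nu> = facet_normal e"
  \<comment> \<open>With this \<open>w\<close>, the map \<open>h\<close> fixes the vectors
    orthogonal to \<nu> and sends \<nu> to \<open>t *\<^sub>R v\<close>; \<open>c\<close> moves the
    origin to the chosen point of \<open>e\<close>.\<close>
  define w where "w = t *\<^sub>R v - \<nu>"
  define h where "h = (\<lambda>z. z + (\<nu> \<bullet> z) *\<^sub>R w)"
  define c where "c = - (\<nu> \<bullet> (SOME a. a \<in> e)) *\<^sub>R w"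
  have n1: "norm \<nu> = 1" using facet_normal_cases(2)[OF e] by (simp add: \<nu>_def)
  then have "det (matrix h) = 1 + \<nu> \<bullet> w" unfolding h_def by (rule det_rank_one_update)
  also have "\<dots> = t * (\<nu> \<bullet> v)"
    using n1 by (simp add: w_def inner_diff_right norm_eq_1)
  finally have det: "det (matrix h) = t * (\<nu> \<bullet> v)" .
  have abs: "\<bar>\<nu> \<bullet> v\<bar> = \<bar>outward_normal K e \<bullet> v\<bar>"
    using facet_normal_cases(1)[OF e] by (auto simp: \<nu>_def)
  have lin: "linear h"
    unfolding h_def by (auto intro!: linearI simp: algebra_simps inner_add_right)
  have g: "h z + c = facet_proj e z + (t * facet_height e z) *\<^sub>R v" for z
    by (simp add: h_def c_def facet_proj_height facet_height_def w_def inner_diff_right \<nu>_def algebra_simps)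
  have "(\<lambda>z. h z + c) ` facet_prism e = sweep v t e"
  proof
    show "(\<lambda>z. h z + c) ` facet_prism e \<subseteq> sweep v t e"
      unfolding facet_prism_def g
    proof clarify
      fix x s assume x: "x \<in> e" and s: "0 \<le> s" "s \<le> (1::real)"
      have "t * s \<le> t" "0 \<le> t * s" using s t by (auto simp: mult_left_le)
      then show "facet_proj e (x + s *\<^sub>R facet_normal e) +
          (t * facet_height e (x + s *\<^sub>R facet_normal e)) *\<^sub>R v \<in> sweep v t e"
        unfolding facet_prism_point[OF e x] sweep_def using x by blast
    qed
    show "sweep v t e \<subseteq> (\<lambda>z. h z + c) ` facet_prism e"
    proof
      fix z assume "z \<in> sweep v t e"
      then obtain x s where z: "z = x + s *\<^sub>R v" "x \<in> e" "0 \<le> s" "s \<le> t" unfolding sweep_def by blast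
      let ?y = "x + (s / t) *\<^sub>R facet_normal e"
      have "0 \<le> s / t" "s / t \<le> 1" using z t by auto
      then have "?y \<in> facet_prism e" using z(2) unfolding facet_prism_def by blast
      moreover have "z = h ?y + c"
        unfolding g facet_prism_point[OF e z(2)] using z t by simp
      ultimately show "z \<in> (\<lambda>z. h z + c) ` facet_prism e" by blast
    qed
  qed
  moreover have "det (matrix h) \<noteq> 0" using det abs v t by auto
  note integral_affine_image[OF lin this compact_facet_prism[OF e] f, of c]
  ultimately show ?thesis unfolding g using det abs t by (simp add: abs_mult)
qed

text \<open>Dominated convergence along \<open>t = 1/(i+1)\<close>. A constant bound exists because
  all the perturbed arguments come from the compact set of parameters
  \<open>{0..1} \<times> S\<close>.\<close>

lemma tendsto_integral_shrinking_perturbation: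
  fixes f :: "'a::euclidean_space \<Rightarrow> real" and p :: "'b::euclidean_space \<Rightarrow> 'a"
  assumes S: "compact S" and p: "continuous_on S p" and \<phi>: "continuous_on S \<phi>"
    and f: "continuous_on UNIV f"
  shows "(\<lambda>i. integral S (\<lambda>z. f (p z + (inverse (real (Suc i)) * \<phi> z) *\<^sub>R v)))
    \<longlonglongrightarrow> integral S (\<lambda>z. f (p z))"
proof -
  let ?q = "\<lambda>(s, z). f (p z + (s * \<phi> z) *\<^sub>R v)"
  have "continuous_on ({0..1} \<times> S) (\<lambda>x. p (snd x) + (fst x * \<phi> (snd x)) *\<^sub>R v)"
    by (intro continuous_intros continuous_on_compose2[OF p] continuous_on_compose2[OF \<phi>]) auto
  then have "continuous_on ({0..1} \<times> S) ?q"
    unfolding case_prod_beta by (rule continuous_on_compose2[OF f]) auto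
  then have "compact (?q ` ({0..1} \<times> S))"
    by (intro compact_continuous_image compact_Times S) auto
  from compact_imp_bounded[OF this]
  obtain B where B: "\<And>y. y \<in> ?q ` ({0..1} \<times> S) \<Longrightarrow> norm y \<le> B"
    unfolding bounded_iff by blast
  show ?thesis
  proof (rule dominated_convergence(2)[where h = "\<lambda>_. B"])
    show "(\<lambda>z. f (p z + (inverse (real (Suc i)) * \<phi> z) *\<^sub>R v)) integrable_on S" for i
      by (intro integrable_continuous_compact S continuous_on_compose2[OF f] continuous_intros p \<phi>) auto
    show "(\<lambda>_. B) integrable_on S"
      by (intro integrable_continuous_compact S continuous_intros)
    show "norm (f (p z + (inverse (real (Suc i)) * \<phi> z) *\<^sub>R v)) \<le> B" if "z \<in> S" for i z
    proof (rule B)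
      have "inverse (real (Suc i)) \<in> {0..1}" by (simp add: field_simps)
      then show "f (p z + (inverse (real (Suc i)) * \<phi> z) *\<^sub>R v) \<in> ?q ` ({0..1} \<times> S)"
        using that by (intro image_eqI[of _ _ "(inverse (real (Suc i)), z)"]) auto
    qed
    show "(\<lambda>i. f (p z + (inverse (real (Suc i)) * \<phi> z) *\<^sub>R v)) \<longlonglongrightarrow> f (p z)" for z
    proof -
      have "(\<lambda>i. p z + (inverse (real (Suc i)) * \<phi> z) *\<^sub>R v) \<longlonglongrightarrow> p z + (0 * \<phi> z) *\<^sub>R v"
        by (intro tendsto_intros LIMSEQ_inverse_real_of_nat)
      then show ?thesis
        using continuous_on_tendsto_compose[OF f, of _ "p z"] by simp
    qed
  qed
qed

text \<open>By the mean value theorem each quotient is a value of the directional derivative on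
  \<open>sweep v 1 S\<close>. That set is compact, which gives a constant dominating
  function.\<close>

lemma tendsto_integral_difference_quotient:
  fixes f :: "'a::euclidean_space \<Rightarrow> real"
  assumes S: "compact S" and f: "\<And>x. (f has_derivative f' x) (at x)"
    and f': "continuous_on UNIV (\<lambda>x. f' x v)"
  shows "(\<lambda>i. integral S (\<lambda>x. (f (x + inverse (real (Suc i)) *\<^sub>R v) - f x) / inverse (real (Suc i))))
    \<longlonglongrightarrow> integral S (\<lambda>x. f' x v)"
proof -
  have line: "((\<lambda>t. f (x + t *\<^sub>R v)) has_real_derivative f' (x + t *\<^sub>R v) v) (at t)" for x t
  proof -
    have "((\<lambda>t. x + t *\<^sub>R v) has_derivative (\<lambda>t. t *\<^sub>R v)) (at t)"
      by (auto intro!: derivative_eq_intros)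
    from has_derivative_compose[OF this f]
    have "((\<lambda>t. f (x + t *\<^sub>R v)) has_derivative (\<lambda>s. f' (x + t *\<^sub>R v) (s *\<^sub>R v))) (at t)" .
    moreover have "linear (f' (x + t *\<^sub>R v))" using f has_derivative_linear by blast
    then have "(\<lambda>s. f' (x + t *\<^sub>R v) (s *\<^sub>R v)) = (*) (f' (x + t *\<^sub>R v) v)"
      by (auto simp: linear_scale)
    ultimately show ?thesis by (simp add: has_field_derivative_def)
  qed
  have contf: "continuous_on T f" for T
    using f by (meson continuous_at_imp_continuous_on has_derivative_continuous)
  have "compact ((\<lambda>x. f' x v) ` sweep v 1 S)"
    by (intro compact_continuous_image compact_sweep S continuous_on_subset[OF f']) auto
  from compact_imp_bounded[OF this]
  obtain B where B: "\<And>y. y \<in> (\<lambda>x. f' x v) ` sweep v 1 S \<Longrightarrow> norm y \<le> B"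
    unfolding bounded_iff by blast
  show ?thesis
  proof (rule dominated_convergence(2)[where h = "\<lambda>_. B"])
    show "(\<lambda>x. (f (x + inverse (real (Suc i)) *\<^sub>R v) - f x) / inverse (real (Suc i))) integrable_on S" for i
      by (intro integrable_continuous_compact S continuous_intros continuous_on_compose2[OF contf[of UNIV]]) auto
    show "(\<lambda>_. B) integrable_on S"
      by (intro integrable_continuous_compact S continuous_intros)
    show "norm ((f (x + inverse (real (Suc i)) *\<^sub>R v) - f x) / inverse (real (Suc i))) \<le> B"
      if "x \<in> S" for i x
    proof -
      define t where "t = inverse (real (Suc i))"
      have t: "0 < t" "t \<le> 1" by (simp_all add: t_def field_simps)
      have "\<exists>z>0. z < t \<and> f (x + t *\<^sub>R v) - f (x + 0 *\<^sub>R v) = (t - 0) * f' (x + z *\<^sub>R v) v"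
        by (intro MVT2 t line)
      then obtain z where z: "0 < z" "z < t" "f (x + t *\<^sub>R v) - f x = t * f' (x + z *\<^sub>R v) v" by auto
      have "x + z *\<^sub>R v \<in> sweep v 1 S"
        using that z t unfolding sweep_def by (intro CollectI exI[of _ x] exI[of _ z]) auto
      then have "norm (f' (x + z *\<^sub>R v) v) \<le> B" by (intro B) blast
      then show ?thesis using z t unfolding t_def[symmetric] by simp
    qed
    show "(\<lambda>i. (f (x + inverse (real (Suc i)) *\<^sub>R v) - f x) / inverse (real (Suc i))) \<longlonglongrightarrow> f' x v" for x
    proof -
      have "((\<lambda>h. (f (x + (0 + h) *\<^sub>R v) - f (x + 0 *\<^sub>R v)) / h) \<longlongrightarrow> f' (x + 0 *\<^sub>R v) v) (at 0)"
        using line[of x 0] unfolding DERIV_def .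
      moreover have "filterlim (\<lambda>i. inverse (real (Suc i))) (at 0) sequentially"
        unfolding filterlim_at using LIMSEQ_inverse_real_of_nat by auto
      ultimately show ?thesis
        using filterlim_compose by fastforce
    qed
  qed
qed

text \<open>Stated for a single direction \<open>v\<close> and its directional derivative;
  coordinate directions later give the divergence.\<close>

theorem divergence_theorem_polytope:
  fixes K :: "(real^'d::{finite,wellorder}) set" and f :: "real^'d::_ \<Rightarrow> real"
  assumes K: "solid_polytope K" and f: "\<And>x. (f has_derivative f' x) (at x)"
    and f': "continuous_on UNIV (\<lambda>x. f' x v)"
  shows "integral K (\<lambda>x. f' x v) = (\<Sum>e | e facet_of K. (outward_normal K e \<bullet> v) * facet_integral e f)"
proof -
  interpret solid_polytope K by (rule K)
  let ?n = "outward_normal K" and ?t = "\<lambda>i. inverse (real (Suc i))"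
  have contf: "continuous_on T f" for T
    using f by (meson continuous_at_imp_continuous_on has_derivative_continuous)
  have fs: "continuous_on T (\<lambda>x. f (x + w))" for T w
    by (rule continuous_on_compose2[OF contf[of UNIV]]) (auto intro!: continuous_intros)
  have quotient: "integral K (\<lambda>x. (f (x + t *\<^sub>R v) - f x) / t) =
     (\<Sum>e\<in>outflow v. (?n e \<bullet> v) * integral (facet_prism e) (\<lambda>z. f (facet_proj e z + (t * facet_height e z) *\<^sub>R v)))
     + (\<Sum>e\<in>outflow (- v). (?n e \<bullet> v) * integral (facet_prism e) (\<lambda>z. f (facet_proj e z + (t * (1 - facet_height e z)) *\<^sub>R v)))"
    (is "_ = ?A + ?B") if t: "t > 0" for t
  proof -
    \<comment> \<open>The swept set is also the sweep of \<open>K\<close> along \<open>- v\<close>,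
      translated by \<open>t *\<^sub>R v\<close>. Decomposing both sweeps expresses one integral in
      two ways.\<close>
    have "(\<lambda>x. id x + t *\<^sub>R v) ` sweep (- v) t K = sweep v t K"
    proof (intro equalityI subsetI)
      fix z assume "z \<in> (\<lambda>x. id x + t *\<^sub>R v) ` sweep (- v) t K"
      then obtain x s where "z = x + s *\<^sub>R (- v) + t *\<^sub>R v" "x \<in> K" "0 \<le> s" "s \<le> t"
        by (auto simp: sweep_def)
      then show "z \<in> sweep v t K"
        unfolding sweep_def by (intro CollectI exI[of _ x] exI[of _ "t - s"]) (auto simp: algebra_simps)
    next
      fix z assume "z \<in> sweep v t K"
      then obtain x s where z: "z = x + s *\<^sub>R v" "x \<in> K" "0 \<le> s" "s \<le> t"
        by (auto simp: sweep_def)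
      then have "x + (t - s) *\<^sub>R (- v) \<in> sweep (- v) t K"
        unfolding sweep_def by (intro CollectI exI[of _ x] exI[of _ "t - s"]) auto
      moreover have "z = id (x + (t - s) *\<^sub>R (- v)) + t *\<^sub>R v"
        using z(1) by (simp add: algebra_simps)
      ultimately show "z \<in> (\<lambda>x. id x + t *\<^sub>R v) ` sweep (- v) t K" by blast
    qed
    moreover have "integral ((\<lambda>x. id x + t *\<^sub>R v) ` sweep (- v) t K) f =
        \<bar>det (matrix (id :: real^'d::_ \<Rightarrow> real^'d::_))\<bar> * integral (sweep (- v) t K) (\<lambda>x. f (id x + t *\<^sub>R v))"
      by (rule integral_affine_image[OF linear_id _ compact_sweep[OF compact_polytope] contf])
        (metis matrix_id_mat_1 det_I zero_neq_one)
    ultimately have "integral (sweep v t K) f = integral (sweep (- v) t K) (\<lambda>x. f (x + t *\<^sub>R v))"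
      by (simp only: matrix_id_mat_1 det_I) simp
    then have "integral K (\<lambda>x. f (x + t *\<^sub>R v)) - integral K f =
        (\<Sum>e\<in>outflow v. integral (sweep v t e) f) -
        (\<Sum>e\<in>outflow (- v). integral (sweep (- v) t e) (\<lambda>x. f (x + t *\<^sub>R v)))"
      using t by (simp add: integral_sweep_polytope[OF _ contf] integral_sweep_polytope[OF _ fs])
    also have "(\<Sum>e\<in>outflow v. integral (sweep v t e) f) = t * ?A"
      unfolding sum_distrib_left
      by (intro sum.cong refl) (auto simp: outflow_def integral_sweep_facet[OF K _ _ t contf])
    also have "(\<Sum>e\<in>outflow (- v). integral (sweep (- v) t e) (\<lambda>x. f (x + t *\<^sub>R v))) = - (t * ?B)"
      unfolding sum_distrib_left sum_negf[symmetric]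
    proof (intro sum.cong refl)
      fix e assume e: "e \<in> outflow (- v)"
      then have 1: "e facet_of K" "?n e \<bullet> - v \<noteq> 0" and 2: "\<bar>?n e \<bullet> - v\<bar> = - (?n e \<bullet> v)"
        by (auto simp: outflow_def)
      \<comment> \<open>The translation reverses the heights: displacement by \<open>t\<close> times
        the height along \<open>- v\<close> becomes \<open>t\<close> times one minus the height
        along \<open>v\<close>. In the limit either weight drops out.\<close>
      have 3: "facet_proj e z + (t * facet_height e z) *\<^sub>R (- v) + t *\<^sub>R v =
        facet_proj e z + (t * (1 - facet_height e z)) *\<^sub>R v" for z
        by (simp add: algebra_simps)
      show "integral (sweep (- v) t e) (\<lambda>x. f (x + t *\<^sub>R v)) =
        - (t * ((?n e \<bullet> v) * integral (facet_prism e) (\<lambda>z. f (facet_proj e z + (t * (1 - facet_height e z)) *\<^sub>R v))))"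
        unfolding integral_sweep_facet[OF K 1 t fs] 2 3 by simp
    qed
    finally have "integral K (\<lambda>x. f (x + t *\<^sub>R v)) - integral K f = t * (?A + ?B)"
      by (simp add: distrib_left)
    moreover have "integral K (\<lambda>x. f (x + t *\<^sub>R v)) - integral K f = integral K (\<lambda>x. f (x + t *\<^sub>R v) - f x)"
      by (intro integral_diff[symmetric] integrable_continuous_compact compact_polytope fs contf)
    ultimately show ?thesis using t by (simp add: integral_divide)
  qed
  have lim: "(\<lambda>i. integral (facet_prism e) (\<lambda>z. f (facet_proj e z + (?t i * \<phi> z) *\<^sub>R v))) \<longlonglongrightarrow> facet_integral e f"
    if "e facet_of K" "continuous_on (facet_prism e) \<phi>" for e \<phi>
    unfolding facet_integral_eq(2)[OF that(1) contf]
    by (intro tendsto_integral_shrinking_perturbation compact_facet_prism that contf continuous_intros)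
  have pos: "?t i > 0" for i by simp
  have "(\<lambda>i. integral K (\<lambda>x. (f (x + ?t i *\<^sub>R v) - f x) / ?t i)) \<longlonglongrightarrow>
     (\<Sum>e\<in>outflow v. (?n e \<bullet> v) * facet_integral e f) + (\<Sum>e\<in>outflow (- v). (?n e \<bullet> v) * facet_integral e f)"
    unfolding quotient[OF pos]
    by (intro tendsto_add tendsto_sum tendsto_mult tendsto_const lim continuous_intros)
      (auto simp: outflow_def)
  from LIMSEQ_unique[OF tendsto_integral_difference_quotient[OF compact_polytope f f'] this]
  have "integral K (\<lambda>x. f' x v) =
     (\<Sum>e\<in>outflow v. (?n e \<bullet> v) * facet_integral e f) + (\<Sum>e\<in>outflow (- v). (?n e \<bullet> v) * facet_integral e f)" .
  also have "\<dots> = (\<Sum>e\<in>outflow v \<union> outflow (- v). (?n e \<bullet> v) * facet_integral e f)"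
    by (intro sum.union_disjoint[symmetric] finite_outflow) (auto simp: outflow_def)
  \<comment> \<open>The facets parallel to \<open>v\<close> are added back with coefficient
    zero.\<close>
  also have "\<dots> = (\<Sum>e | e facet_of K. (?n e \<bullet> v) * facet_integral e f)"
    by (intro sum.mono_neutral_left finite_facets) (auto simp: outflow_def)
  finally show ?thesis .
qed

subsection \<open>Discrete velocities\<close>

lemma mesh_element_solid_polytope:
  assumes "mesh_of \<Omega> \<T>" "K \<in> \<T>"
  shows "solid_polytope K"
proof
  have K: "int DIM('a) simplex K" using assms by (auto simp: mesh_of_def)
  then show "polytope K" by (rule simplex_imp_polytope)
  have "aff_dim K = int DIM('a)" using K by (rule aff_dim_simplex)
  then show "interior K \<noteq> {}"
    using interior_rel_interior_gen[of K] rel_interior_eq_empty[OF convex_simplex[OF K]] by auto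
qed

text \<open>Integration by parts: the scalar theorem is applied to \<open>p i\<close> times
  \<open>q\<close> in the coordinate direction \<open>i\<close> and summed over
  \<open>i\<close>.\<close>

lemma divergence_theorem_vector:
  fixes K :: "(real^'d::{finite,wellorder}) set" and p :: "'d \<Rightarrow> real^'d::_ \<Rightarrow> real"
  assumes K: "solid_polytope K"
    and p: "\<And>i x. (p i has_derivative (\<lambda>h. \<Sum>l\<in>UNIV. P i l x * h $ l)) (at x)"
      "\<And>i l. continuous_on UNIV (P i l)"
    and q: "\<And>x. (q has_derivative (\<lambda>h. \<Sum>l\<in>UNIV. Q l x * h $ l)) (at x)"
      "\<And>l. continuous_on UNIV (Q l)"
  shows "integral K (\<lambda>x. \<Sum>i\<in>UNIV. p i x * Q i x) + integral K (\<lambda>x. (\<Sum>i\<in>UNIV. P i i x) * q x)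
    = (\<Sum>e | e facet_of K. facet_integral e (\<lambda>x. (\<Sum>i\<in>UNIV. p i x * outward_normal K e $ i) * q x))"
proof -
  interpret solid_polytope K by (rule K)
  have cp: "continuous_on T (p i)" for i T
    using p(1) by (meson continuous_at_imp_continuous_on has_derivative_continuous)
  have cq: "continuous_on T q" for T
    using q(1) by (meson continuous_at_imp_continuous_on has_derivative_continuous)
  have cP: "continuous_on T (P i l)" and cQ: "continuous_on T (Q l)" for i l T
    using p(2) q(2) by (meson continuous_on_subset subset_UNIV)+
  have axis: "(\<Sum>l\<in>UNIV. c l * axis i (1::real) $ l) = c i" for c i
    by (simp add: axis_def if_distrib[of "\<lambda>t. _ * t"] cong: if_cong)
  have div: "integral K (\<lambda>x. p i x * Q i x + P i i x * q x) =
      (\<Sum>e | e facet_of K. outward_normal K e $ i * facet_integral e (\<lambda>x. p i x * q x))" for i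
    using divergence_theorem_polytope[OF K has_derivative_mult[OF p(1)[of i] q(1)], of "axis i 1"]
    by (simp add: axis inner_axis continuous_intros cp cP cq cQ)
  have int: "(\<lambda>x. f x) integrable_on K" if "continuous_on K f" for f :: "_ \<Rightarrow> real"
    using that compact_polytope by (intro integrable_continuous_compact)
  have "integral K (\<lambda>x. \<Sum>i\<in>UNIV. p i x * Q i x) + integral K (\<lambda>x. (\<Sum>i\<in>UNIV. P i i x) * q x)
      = integral K (\<lambda>x. \<Sum>i\<in>UNIV. p i x * Q i x + P i i x * q x)"
    unfolding sum.distrib sum_distrib_right
    by (intro integral_add[symmetric] int continuous_intros cp cQ cP cq)
  also have "\<dots> = (\<Sum>i\<in>UNIV. integral K (\<lambda>x. p i x * Q i x + P i i x * q x))"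
    by (intro integral_sum int continuous_intros cp cQ cP cq) auto
  also have "\<dots> = (\<Sum>e | e facet_of K. \<Sum>i\<in>UNIV. outward_normal K e $ i * facet_integral e (\<lambda>x. p i x * q x))"
    unfolding div by (rule sum.swap)
  also have "\<dots> = (\<Sum>e | e facet_of K. facet_integral e (\<lambda>x. (\<Sum>i\<in>UNIV. p i x * outward_normal K e $ i) * q x))"
  proof (intro sum.cong refl)
    fix e assume "e \<in> {e. e facet_of K}"
    then have e: "e facet_of K" by simp
    let ?n = "outward_normal K e" and ?P = "facet_prism e" and ?\<pi> = "facet_proj e"
    have cpr: "continuous_on ?P (\<lambda>z. p i (?\<pi> z))" "continuous_on ?P (\<lambda>z. q (?\<pi> z))" for i
      using facet_integral_eq(1)[OF e] cp cq by blast+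
    have "(\<Sum>i\<in>UNIV. ?n $ i * facet_integral e (\<lambda>x. p i x * q x)) =
        (\<Sum>i\<in>UNIV. integral ?P (\<lambda>z. ?n $ i * (p i (?\<pi> z) * q (?\<pi> z))))"
      by (simp add: facet_integral_eq(2)[OF e] cp cq continuous_intros)
    also have "\<dots> = integral ?P (\<lambda>z. \<Sum>i\<in>UNIV. ?n $ i * (p i (?\<pi> z) * q (?\<pi> z)))"
      by (intro integral_sum[symmetric] integrable_continuous_compact compact_facet_prism e
          continuous_intros cpr) auto
    also have "\<dots> = facet_integral e (\<lambda>x. (\<Sum>i\<in>UNIV. p i x * ?n $ i) * q x)"
      by (simp add: facet_integral_eq(2)[OF e] cp cq continuous_intros sum_distrib_left mult_ac)
    finally show "(\<Sum>i\<in>UNIV. ?n $ i * facet_integral e (\<lambda>x. p i x * q x)) =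
      facet_integral e (\<lambda>x. (\<Sum>i\<in>UNIV. p i x * ?n $ i) * q x)" .
  qed
  finally show ?thesis .
qed

lemma divergence_free_if_weakly_divergence_free:
  fixes u :: "real^'d::{finite,wellorder} \<Rightarrow> real^'d::_"
  assumes K: "solid_polytope K" and u: "vpoly_on k K u"
    and weak: "\<And>q. poly_on (k - 1) K q \<Longrightarrow>
      - vol_ip K u (grad_on K q) + bdry_ip K (\<lambda>e x. u x \<bullet> outward_normal K e) q = 0"
    and x: "x \<in> K"
  shows "div_on K u x = 0"
proof -
  interpret solid_polytope K by (rule K)
  have cvx: "convex K" using polytope by (rule polytope_imp_convex)
  \<comment> \<open>\<open>u\<close> is polynomial on \<open>K\<close> only; the extensions
    \<open>p i\<close> are differentiable on the whole space, as the divergence theorem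
    requires.\<close>
  have "\<forall>i. \<exists>p\<in>polys k. \<forall>x\<in>K. u x $ i = p x" using u by (simp add: vpoly_on_def poly_on_def)
  then obtain p where p: "\<And>i. p i \<in> polys k" "\<And>i x. x \<in> K \<Longrightarrow> u x $ i = p i x" by metis
  have "\<forall>i. \<exists>D. (\<forall>l. D l \<in> polys (k - 1)) \<and>
      (\<forall>x. (p i has_derivative (\<lambda>h. \<Sum>l\<in>UNIV. D l x * h $ l)) (at x))"
  proof
    fix i
    show "\<exists>D. (\<forall>l. D l \<in> polys (k - 1)) \<and>
      (\<forall>x. (p i has_derivative (\<lambda>h. \<Sum>l\<in>UNIV. D l x * h $ l)) (at x))"
      by (rule polys_derivative[OF p(1)[of i]]) blast
  qed
  from choice[OF this] obtain P where P: "\<And>i l. P i l \<in> polys (k - 1)"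
      "\<And>i x. (p i has_derivative (\<lambda>h. \<Sum>l\<in>UNIV. P i l x * h $ l)) (at x)" by blast
  \<comment> \<open>The divergence of the extension, of degree at most \<open>k - 1\<close> and so
    itself an admissible test function.\<close>
  define q where "q = (\<lambda>x. \<Sum>i\<in>UNIV. P i i x)"
  have q: "q \<in> polys (k - 1)" unfolding q_def by (intro polys_sum P)
  then obtain Q where Q: "\<And>l. Q l \<in> polys (k - 1 - 1)"
      "\<And>x. (q has_derivative (\<lambda>h. \<Sum>l\<in>UNIV. Q l x * h $ l)) (at x)"
    by (rule polys_derivative) blast
  note cont = continuous_on_polys[OF p(1)] continuous_on_polys[OF P(1)]
    continuous_on_polys[OF q] continuous_on_polys[OF Q(1)]
  have div: "div_on K u x = q x" if "x \<in> K" for x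
    unfolding div_on_def q_def
  proof (intro sum.cong refl)
    show "partial_on K i (\<lambda>y. u y $ i) x = P i i x" for i
      by (rule partial_on_poly[OF cvx interior that]) (rule p(2) P(2), assumption?)+
  qed
  have grad: "grad_on K q x $ l = Q l x" if "x \<in> K" for x l
    using partial_on_poly[OF cvx interior that, of q q Q l] Q(2) by (simp add: grad_on_def)
  have "vol_ip K u (grad_on K q) = (LINT x:K|lebesgue. \<Sum>i\<in>UNIV. p i x * Q i x)"
    unfolding vol_ip_def
    by (intro set_lebesgue_integral_cong)
      (auto simp: inner_vec_def p(2) grad compact_polytope lmeasurable_compact fmeasurableD)
  also have "\<dots> = integral K (\<lambda>x. \<Sum>i\<in>UNIV. p i x * Q i x)"
    by (intro set_integral_continuous_compact compact_polytope continuous_intros cont)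
  finally have vol: "vol_ip K u (grad_on K q) = integral K (\<lambda>x. \<Sum>i\<in>UNIV. p i x * Q i x)" .
  have "bdry_ip K (\<lambda>e x. u x \<bullet> outward_normal K e) q =
    (\<Sum>e | e facet_of K. facet_integral e (\<lambda>x. (\<Sum>i\<in>UNIV. p i x * outward_normal K e $ i) * q x))"
    unfolding bdry_ip_def facet_ip_def
  proof (intro sum.cong refl facet_integral_cong)
    fix e x assume e: "e \<in> {e. e facet_of K}" and x: "x \<in> e"
    then have "x \<in> K" using facet_subset by blast
    then show "(u x \<bullet> outward_normal K e) \<bullet> q x = (\<Sum>i\<in>UNIV. p i x * outward_normal K e $ i) * q x"
      by (simp add: inner_vec_def p(2))
  qed auto
  also have "\<dots> = integral K (\<lambda>x. \<Sum>i\<in>UNIV. p i x * Q i x) + integral K (\<lambda>x. q x * q x)"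
    using divergence_theorem_vector[OF K P(2) cont(2) Q(2) cont(4)] by (simp add: q_def)
  \<comment> \<open>The boundary term equals the volume term plus the integral of the square; the
    weak equation cancels the first two.\<close>
  finally have "integral K (\<lambda>x. q x * q x) = 0"
    using weak[of q] q vol by (auto simp: poly_on_def)
  then have "q x * q x = 0"
    by (intro integral_eq_0_imp_eq_0[OF compact_polytope cvx interior, of "\<lambda>x. q x * q x"] x
        continuous_intros cont) auto
  then show ?thesis using div[OF x] by simp
qed

text \<open>The conditions (L3), (C2) and (B1) contain no cross product, so one statement with
  arbitrary \<open>X\<close> serves both dimensions.\<close>

lemma ehdg_velocity_divergence_conforming:
  fixes \<Omega> :: "(real^'d::{finite,wellorder}) set" and S :: "('d::{finite,wellorder}, 'h::finite) ehdg_unknowns"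
  assumes mesh: "mesh_of \<Omega> \<T>" and sol: "ehdg_solution X \<Omega> \<T> k D S"
  shows "\<forall>K\<in>\<T>. \<forall>x\<in>K. div_on K (u_h S K) x = 0"
    and "\<forall>e\<in>interior_facets \<Omega> \<T>. \<forall>K\<^sub>1 K\<^sub>2. facet_between \<T> e K\<^sub>1 K\<^sub>2 \<longrightarrow>
       (\<forall>x\<in>e. jump (\<lambda>K e x. u_h S K x \<bullet> outward_normal K e) K\<^sub>1 K\<^sub>2 e x = 0)"
    and "\<forall>e\<in>boundary_facets \<Omega> \<T>. \<forall>K\<in>\<T>. e facet_of K \<longrightarrow>
       (\<forall>x\<in>e. u_h S K x \<bullet> outward_normal K e = u_hat S x \<bullet> outward_normal K e)"
proof -
  have poly: "vpoly_on k K (u_h S K)" if "K \<in> \<T>" for K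
    using sol that by (simp add: ehdg_solution_def ehdg_spaces_def)
  have flux3: "flux3 S = (\<lambda>K e x. u_h S K x \<bullet> outward_normal K e)"
    by (simp add: flux3_def fun_eq_iff)
  show "\<forall>K\<in>\<T>. \<forall>x\<in>K. div_on K (u_h S K) x = 0"
  proof (intro ballI)
    fix K x assume K: "K \<in> \<T>" and x: "x \<in> K"
    have "local_equations X k D S K" using sol K by (simp add: ehdg_solution_def)
    then have "- vol_ip K (u_h S K) (grad_on K q) + bdry_ip K (flux3 S K) q = 0"
      if "poly_on (k - 1) K q" for q
      using that unfolding local_equations_def by blast
    then show "div_on K (u_h S K) x = 0"
      using divergence_free_if_weakly_divergence_free[OF mesh_element_solid_polytope[OF mesh K] poly[OF K] _ x]
      unfolding flux3 by blast
  qed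
  show "\<forall>e\<in>interior_facets \<Omega> \<T>. \<forall>K\<^sub>1 K\<^sub>2. facet_between \<T> e K\<^sub>1 K\<^sub>2 \<longrightarrow>
       (\<forall>x\<in>e. jump (\<lambda>K e x. u_h S K x \<bullet> outward_normal K e) K\<^sub>1 K\<^sub>2 e x = 0)"
  proof (intro ballI allI impI)
    fix e K\<^sub>1 K\<^sub>2 x
    assume e: "e \<in> interior_facets \<Omega> \<T>" and between: "facet_between \<T> e K\<^sub>1 K\<^sub>2" and x: "x \<in> e"
    \<comment> \<open>This element gives meaning to integration over \<open>e\<close>. Membership of
      \<open>e\<close> in \<open>K\<^sub>1\<close> and \<open>K\<^sub>2\<close> comes instead from
      their frontiers, whose intersection it is.\<close>
    obtain K where K: "K \<in> \<T>" "e facet_of K" using e by (auto simp: interior_facets_def facets_def)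
    interpret solid_polytope K by (rule mesh_element_solid_polytope[OF mesh K(1)])
    have sub: "e \<subseteq> K'" if "K' \<in> \<T>" "e \<subseteq> frontier K'" for K'
      using that solid_polytope.compact_polytope[OF mesh_element_solid_polytope[OF mesh that(1)]]
        frontier_subset_closed compact_imp_closed by blast
    have normal: "poly_on k e (\<lambda>x. u_h S K' x \<bullet> outward_normal K' e)" if "K' \<in> \<T>" "e \<subseteq> frontier K'" for K'
      by (rule poly_on_subset[OF poly_on_inner_const[OF poly[OF that(1)]] sub[OF that]])
    let ?j = "jump (\<lambda>K e x. u_h S K x \<bullet> outward_normal K e) K\<^sub>1 K\<^sub>2 e"
    \<comment> \<open>On a fixed \<open>e\<close> both normals are constant vectors, so the jump is
      a polynomial of degree at most \<open>k\<close> and may be its own test function.\<close>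
    have j: "poly_on k e ?j"
      using between unfolding jump_def facet_between_def by (intro poly_on_add normal) auto
    have "conservation_conditions X \<Omega> \<T> k D S" using sol by (simp add: ehdg_solution_def)
    then have "facet_ip e (jump (flux3 S) K\<^sub>1 K\<^sub>2 e) ?j = 0"
      using e between j unfolding conservation_conditions_def by blast
    then show "?j x = 0"
      unfolding flux3 facet_ip_def
      by (intro facet_integral_square_eq_0[OF K(2) continuous_on_poly_on[OF j] _ x]) simp
  qed
  show "\<forall>e\<in>boundary_facets \<Omega> \<T>. \<forall>K\<in>\<T>. e facet_of K \<longrightarrow>
       (\<forall>x\<in>e. u_h S K x \<bullet> outward_normal K e = u_hat S x \<bullet> outward_normal K e)"
  proof (intro ballI impI)
    fix e K x assume e: "e \<in> boundary_facets \<Omega> \<T>" and K: "K \<in> \<T>" "e facet_of K" and x: "x \<in> e"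
    interpret solid_polytope K by (rule mesh_element_solid_polytope[OF mesh K(1)])
    let ?n = "outward_normal K e"
    have a: "poly_on k e (\<lambda>x. u_h S K x \<bullet> ?n)"
      by (rule poly_on_subset[OF poly_on_inner_const[OF poly[OF K(1)]] facet_subset[OF K(2)]])
    have "vpoly_on k e (u_hat S)"
      using sol e by (auto simp: ehdg_solution_def ehdg_spaces_def trace_space_def boundary_facets_def)
    then have b: "poly_on k e (\<lambda>x. u_hat S x \<bullet> ?n)" by (rule poly_on_inner_const)
    \<comment> \<open>The difference of the two normal velocities, used as the test function in
      (B1); the factor -1 lets it be built by \<open>poly_on_add\<close> and
      \<open>poly_on_cmult\<close>.\<close>
    define r where "r x = u_hat S x \<bullet> ?n + (- 1) * (u_h S K x \<bullet> ?n)" for x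
    have r: "poly_on k e r"
      unfolding r_def by (intro poly_on_add poly_on_cmult a b)
    note cont = continuous_on_poly_on[OF a] continuous_on_poly_on[OF b] continuous_on_poly_on[OF r]
    have "boundary_constraints \<Omega> \<T> k S" using sol by (simp add: ehdg_solution_def)
    then have "facet_ip e (\<lambda>x. u_hat S x \<bullet> ?n) r = facet_ip e (\<lambda>x. u_h S K x \<bullet> ?n) r"
      using e K r unfolding boundary_constraints_def Let_def by blast
    moreover have "facet_integral e (\<lambda>x. r x * r x) =
        facet_integral e (\<lambda>x. (u_hat S x \<bullet> ?n) * r x) - facet_integral e (\<lambda>x. (u_h S K x \<bullet> ?n) * r x)"
    proof -
      note ct = continuous_on_mult[OF cont(1,3)] continuous_on_mult[OF cont(2,3)] continuous_on_mult[OF cont(3,3)]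
      note eq = facet_integral_eq[OF K(2) ct(1)] facet_integral_eq[OF K(2) ct(2)] facet_integral_eq[OF K(2) ct(3)]
      show ?thesis
        unfolding eq
        by (subst integral_diff[symmetric, OF integrable_continuous_compact[OF compact_facet_prism[OF K(2)] eq(3)]
              integrable_continuous_compact[OF compact_facet_prism[OF K(2)] eq(1)]])
          (intro integral_cong, simp add: r_def algebra_simps)
    qed
    ultimately have "r x = 0"
      by (intro facet_integral_square_eq_0[OF K(2) cont(3) _ x]) (simp add: facet_ip_def)
    then show "u_h S K x \<bullet> ?n = u_hat S x \<bullet> ?n" by (simp add: r_def)
  qed
qed

theorem proposition1:
  shows
    "(\<forall>(\<Omega> :: (real^2) set) \<T> \<sigma> (k :: nat) (D :: 2 mhd_data) (S :: (2, 1) ehdg_unknowns).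
        admissible_domain \<Omega> \<and> mesh_of \<Omega> \<T> \<and> shape_regular \<sigma> \<T> \<and> k \<ge> 1 \<and>
        admissible_data \<Omega> \<T> D \<and> ehdg_solution calculus_2d \<Omega> \<T> k D S \<longrightarrow>
        (\<forall>K\<in>\<T>. \<forall>x\<in>K. div_on K (u_h S K) x = 0) \<and>
        (\<forall>e\<in>interior_facets \<Omega> \<T>. \<forall>K\<^sub>1 K\<^sub>2. facet_between \<T> e K\<^sub>1 K\<^sub>2 \<longrightarrow>
           (\<forall>x\<in>e. jump (\<lambda>K e x. u_h S K x \<bullet> outward_normal K e) K\<^sub>1 K\<^sub>2 e x = 0)) \<and>
        (\<forall>e\<in>boundary_facets \<Omega> \<T>. \<forall>K\<in>\<T>. e facet_of K \<longrightarrow>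
           (\<forall>x\<in>e. u_h S K x \<bullet> outward_normal K e = u_hat S x \<bullet> outward_normal K e)))
     \<and>
     (\<forall>(\<Omega> :: (real^3) set) \<T> \<sigma> (k :: nat) (D :: 3 mhd_data) (S :: (3, 3) ehdg_unknowns).
        admissible_domain \<Omega> \<and> mesh_of \<Omega> \<T> \<and> shape_regular \<sigma> \<T> \<and> k \<ge> 1 \<and>
        admissible_data \<Omega> \<T> D \<and> ehdg_solution calculus_3d \<Omega> \<T> k D S \<longrightarrow>
        (\<forall>K\<in>\<T>. \<forall>x\<in>K. div_on K (u_h S K) x = 0) \<and>
        (\<forall>e\<in>interior_facets \<Omega> \<T>. \<forall>K\<^sub>1 K\<^sub>2. facet_between \<T> e K\<^sub>1 K\<^sub>2 \<longrightarrow>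
           (\<forall>x\<in>e. jump (\<lambda>K e x. u_h S K x \<bullet> outward_normal K e) K\<^sub>1 K\<^sub>2 e x = 0)) \<and>
        (\<forall>e\<in>boundary_facets \<Omega> \<T>. \<forall>K\<in>\<T>. e facet_of K \<longrightarrow>
           (\<forall>x\<in>e. u_h S K x \<bullet> outward_normal K e = u_hat S x \<bullet> outward_normal K e)))"
  by (intro conjI allI impI; elim conjE)
    (erule (1) ehdg_velocity_divergence_conforming)+

end
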